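(* Let $(\tilde G,\varphi)$ be a periodic multigraph whose quotient colored graph $(G,\gamma)$ has $m$ edges. There is a proper algebraic subset $X\subsetneq\mathbb{R}^{2m}$ such that for every assignment $\mathbf d=(\mathbf d_{ij})_{ij\in E(G)}\in\mathbb{R}^{2m}\setminus X$ of directions to the edges of $G$, the periodic direction network $(\tilde G,\varphi,\tilde{\mathbf d})$ obtained by giving every lift of $ij$ (oriented from a lift of $i$) the direction $\mathbf d_{ij}$ has a faithful realization that is unique up to translation and scaling if and only if $(G,\gamma)$ is colored-Laman.
   Context: A periodic multigraph $(\tilde G,\varphi)$ is an infinite multigraph with a free action $\varphi$ of $\mathbb{Z}^2$ on vertices and edges with finitely many orbits. Its quotient colored graph $(G,\gamma)$: $G=\tilde G/\mathbb{Z}^2$ oriented arbitrarily; choose a representative $\tilde i$ of each vertex orbit $i$; for each edge $ij$ of $G$ take the lift with tail $\tilde i$, whose head is $\gamma\cdot\tilde j$ for a unique $\gamma\in\mathbb{Z}^2$; set $\gamma_{ij}=\gamma$. For a simple cycle $C$ of $G$ (self-loops count as cycles) with a traversal order, $\rho(C)=\sum_{ij\text{ traversed }i\to j}\gamma_{ij}-\sum_{ij\text{ traversed }j\to i}\gamma_{ij}$; the $\mathbb{Z}^2$-rank $\mathrm{rk}(G,\gamma)$ is the rank of the subgroup generated by all $\rho(C)$. Subgraphs are edge-induced, with $n'$ vertices, $m'$ edges, $c'$ components. $(G,\gamma)$ (with $n$ vertices) is colored-Laman if $m=2n+1$ and every subgraph satisfies $m'\le 2n'-3+2\,\mathrm{rk}(G',\gamma)-2(c'-1)$.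 A realization of $(\tilde G,\varphi,\tilde{\mathbf d})$ is a map $\tilde{\mathbf p}:V(\tilde G)\to\mathbb{R}^2$ and $\mathbf L\in\mathrm{Mat}_{2\times2}(\mathbb{R})$ with $\tilde{\mathbf p}_{\gamma\cdot i}=\tilde{\mathbf p}_i+\mathbf L\gamma$ for all $\gamma\in\mathbb{Z}^2$ and $\tilde{\mathbf p}_j-\tilde{\mathbf p}_i=\alpha_{ij}\tilde{\mathbf d}_{ij}$ for some $\alpha_{ij}\in\mathbb{R}$, for every edge $ij$. An edge is collapsed if its endpoints coincide; a realization is faithful if no edge is collapsed. Unique up to translation and scaling means any two faithful realizations $(\tilde{\mathbf p},\mathbf L),(\tilde{\mathbf p}',\mathbf L')$ satisfy $\tilde{\mathbf p}'=\lambda\tilde{\mathbf p}+\mathbf t$, $\mathbf L'=\lambda\mathbf L$ for some $\lambda\in\mathbb{R}\setminus\{0\}$, $\mathbf t\in\mathbb{R}^2$. *)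

theory Defs
  imports
    "HOL-Analysis.Analysis"
    "HOL-Library.Uprod"
    "HOL-Library.FuncSet"
    "HOL-Computational_Algebra.Group_Closure"
begin

section \<open>Periodic multigraphs\<close>

record ('v, 'e) multigraph =
  Verts :: "'v set"
  Edges :: "'e set"
  ends :: "'e \<Rightarrow> 'v uprod"

record ('v, 'e) periodic_multigraph = "('v, 'e) multigraph" +
  vact :: "int^2 \<Rightarrow> 'v \<Rightarrow> 'v"
  eact :: "int^2 \<Rightarrow> 'e \<Rightarrow> 'e"

definition free_action_on :: "(int^2 \<Rightarrow> 'a \<Rightarrow> 'a) \<Rightarrow> 'a set \<Rightarrow> bool" where
  "free_action_on act A \<longleftrightarrow>
     (\<forall>g. \<forall>a\<in>A. act g a \<in> A) \<and>
     (\<forall>a\<in>A. act 0 a = a) \<and>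
     (\<forall>g h. \<forall>a\<in>A. act (g + h) a = act g (act h a)) \<and>
     (\<forall>g. \<forall>a\<in>A. act g a = a \<longrightarrow> g = 0)"

definition orbit :: "(int^2 \<Rightarrow> 'a \<Rightarrow> 'a) \<Rightarrow> 'a \<Rightarrow> 'a set" where
  "orbit act a = range (\<lambda>g. act g a)"

definition is_periodic_multigraph :: "('v, 'e) periodic_multigraph \<Rightarrow> bool" where
  "is_periodic_multigraph G \<longleftrightarrow>
     infinite (Verts G) \<and>
     (\<forall>e\<in>Edges G. set_uprod (ends G e) \<subseteq> Verts G) \<and>
     free_action_on (vact G) (Verts G) \<and>
     free_action_on (eact G) (Edges G) \<and>
     (\<forall>g. \<forall>e\<in>Edges G. ends G (eact G g e) = map_uprod (vact G g) (ends G e)) \<and>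
     finite (orbit (vact G) ` Verts G) \<and>
     finite (orbit (eact G) ` Edges G)"


section \<open>Colored graphs\<close>

record ('v, 'e) colored_graph =
  cverts :: "'v set"
  cedges :: "'e set"
  tail :: "'e \<Rightarrow> 'v"
  head :: "'e \<Rightarrow> 'v"
  color :: "'e \<Rightarrow> int^2"

text \<open>
  An orientation of the quotient graph, including a sense of traversal for each of its
  self-loops, is the same thing as an orientation of the periodic graph that is invariant
  under the action.
\<close>

definition invariant_orientation ::
  "('v, 'e) periodic_multigraph \<Rightarrow> ('e \<Rightarrow> 'v) \<Rightarrow> ('e \<Rightarrow> 'v) \<Rightarrow> bool" where
  "invariant_orientation G src tgt \<longleftrightarrow>
     (\<forall>e\<in>Edges G. ends G e = Upair (src e) (tgt e)) \<and>
     (\<forall>g. \<forall>e\<in>Edges G. src (eact G g e) = vact G g (src e) \<and> tgt (eact G g e) = vact G g (tgt e))"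

definition orbit_representatives ::
  "('v, 'e) periodic_multigraph \<Rightarrow> ('v set \<Rightarrow> 'v) \<Rightarrow> bool" where
  "orbit_representatives G rep \<longleftrightarrow> (\<forall>i \<in> orbit (vact G) ` Verts G. rep i \<in> i)"

text \<open>
  Vertices and edges of the quotient are orbits. For an edge orbit \<open>\<epsilon>\<close>, the image \<open>src ` \<epsilon>\<close>
  is the orbit of the tail of any edge in \<open>\<epsilon>\<close>, by invariance of the orientation.
\<close>

definition quotient_colored_graph ::
  "('v, 'e) periodic_multigraph \<Rightarrow> ('e \<Rightarrow> 'v) \<Rightarrow> ('e \<Rightarrow> 'v) \<Rightarrow> ('v set \<Rightarrow> 'v)
     \<Rightarrow> ('v set, 'e set) colored_graph" where
  "quotient_colored_graph G src tgt rep =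
     \<lparr> cverts = orbit (vact G) ` Verts G,
       cedges = orbit (eact G) ` Edges G,
       tail = (\<lambda>\<epsilon>. src ` \<epsilon>),
       head = (\<lambda>\<epsilon>. tgt ` \<epsilon>),
       color = (\<lambda>\<epsilon>. THE g. \<exists>e\<in>\<epsilon>. src e = rep (src ` \<epsilon>) \<and> tgt e = vact G g (rep (tgt ` \<epsilon>))) \<rparr>"

text \<open>
  A cycle with a traversal order is a list of steps; \<open>(e, True)\<close> traverses \<open>e\<close> from tail to
  head and \<open>(e, False)\<close> from head to tail.
\<close>

definition step_from :: "('v, 'e) colored_graph \<Rightarrow> 'e \<times> bool \<Rightarrow> 'v" where
  "step_from G s = (if snd s then tail G (fst s) else head G (fst s))"

definition step_to :: "('v, 'e) colored_graph \<Rightarrow> 'e \<times> bool \<Rightarrow> 'v" where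
  "step_to G s = (if snd s then head G (fst s) else tail G (fst s))"

definition simple_cycle :: "('v, 'e) colored_graph \<Rightarrow> 'e set \<Rightarrow> ('e \<times> bool) list \<Rightarrow> bool" where
  "simple_cycle G F C \<longleftrightarrow>
     C \<noteq> [] \<and> fst ` set C \<subseteq> F \<and>
     distinct (map fst C) \<and> distinct (map (step_from G) C) \<and>
     (\<forall>k < length C. step_to G (C ! k) = step_from G (C ! (Suc k mod length C)))"

definition cycle_color :: "('v, 'e) colored_graph \<Rightarrow> ('e \<times> bool) list \<Rightarrow> int^2" where
  "cycle_color G C = (\<Sum>s\<leftarrow>C. if snd s then color G (fst s) else - color G (fst s))"

lemma module_int_vec: "module ((*s) :: int \<Rightarrow> int^2 \<Rightarrow> int^2)"
  by unfold_locales (simp_all add: vec_eq_iff algebra_simps)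

text \<open>The rank of an abelian group: the maximal size of a set independent over the integers.\<close>

definition group_rank :: "(int^2) set \<Rightarrow> nat" where
  "group_rank H =
     Max {card B |B. finite B \<and> B \<subseteq> H \<and> \<not> module.dependent ((*s) :: int \<Rightarrow> int^2 \<Rightarrow> int^2) B}"

text \<open>The subgraphs below are the edge-induced ones, given by their edge sets \<open>F\<close>.\<close>

definition Z2_rank :: "('v, 'e) colored_graph \<Rightarrow> 'e set \<Rightarrow> nat" where
  "Z2_rank G F = group_rank (group_closure {cycle_color G C |C. simple_cycle G F C})"

definition induced_verts :: "('v, 'e) colored_graph \<Rightarrow> 'e set \<Rightarrow> 'v set" where
  "induced_verts G F = tail G ` F \<union> head G ` F"

definition adjacency :: "('v, 'e) colored_graph \<Rightarrow> 'e set \<Rightarrow> 'v rel" where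
  "adjacency G F = (\<lambda>e. (tail G e, head G e)) ` F \<union> (\<lambda>e. (head G e, tail G e)) ` F"

definition induced_components :: "('v, 'e) colored_graph \<Rightarrow> 'e set \<Rightarrow> 'v set set" where
  "induced_components G F = induced_verts G F // (adjacency G F)\<^sup>*"

text \<open>The subgraph without edges violates the inequality (it would read \<open>0 \<le> -1\<close>) and is
  excluded.\<close>

definition colored_Laman :: "('v, 'e) colored_graph \<Rightarrow> bool" where
  "colored_Laman G \<longleftrightarrow>
     card (cedges G) = 2 * card (cverts G) + 1 \<and>
     (\<forall>F. F \<subseteq> cedges G \<and> F \<noteq> {} \<longrightarrow>
        int (card F) \<le> 2 * int (card (induced_verts G F)) - 3 + 2 * int (Z2_rank G F)
                         - 2 * (int (card (induced_components G F)) - 1))"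


section \<open>Periodic direction networks\<close>

definition lifted_directions ::
  "('v, 'e) periodic_multigraph \<Rightarrow> ('e set \<Rightarrow> real^2) \<Rightarrow> 'e \<Rightarrow> real^2" where
  "lifted_directions G d e = d (orbit (eact G) e)"

definition realization ::
  "('v, 'e) periodic_multigraph \<Rightarrow> ('e \<Rightarrow> 'v) \<Rightarrow> ('e \<Rightarrow> 'v) \<Rightarrow> ('e \<Rightarrow> real^2)
     \<Rightarrow> ('v \<Rightarrow> real^2) \<Rightarrow> real^2^2 \<Rightarrow> bool" where
  "realization G src tgt d p L \<longleftrightarrow>
     (\<forall>g. \<forall>v\<in>Verts G. p (vact G g v) = p v + L *v (\<chi> k. real_of_int (g $ k))) \<and>
     (\<forall>e\<in>Edges G. \<exists>\<alpha>. p (tgt e) - p (src e) = \<alpha> *\<^sub>R d e)"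

definition faithful_realization ::
  "('v, 'e) periodic_multigraph \<Rightarrow> ('e \<Rightarrow> 'v) \<Rightarrow> ('e \<Rightarrow> 'v) \<Rightarrow> ('e \<Rightarrow> real^2)
     \<Rightarrow> ('v \<Rightarrow> real^2) \<Rightarrow> real^2^2 \<Rightarrow> bool" where
  "faithful_realization G src tgt d p L \<longleftrightarrow>
     realization G src tgt d p L \<and> (\<forall>e\<in>Edges G. p (src e) \<noteq> p (tgt e))"

definition unique_faithful_realization ::
  "('v, 'e) periodic_multigraph \<Rightarrow> ('e \<Rightarrow> 'v) \<Rightarrow> ('e \<Rightarrow> 'v) \<Rightarrow> ('e \<Rightarrow> real^2) \<Rightarrow> bool" where
  "unique_faithful_realization G src tgt d \<longleftrightarrow>
     (\<exists>p L. faithful_realization G src tgt d p L) \<and>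
     (\<forall>p L p' L'. faithful_realization G src tgt d p L \<and> faithful_realization G src tgt d p' L' \<longrightarrow>
        (\<exists>l t. l \<noteq> 0 \<and> (\<forall>v\<in>Verts G. p' v = l *\<^sub>R p v + t) \<and> L' = l *\<^sub>R L))"


section \<open>Algebraic subsets of the space of direction assignments\<close>

text \<open>For an edge set \<open>E\<close> with \<open>m\<close> elements, \<open>direction_space E\<close> is the space of \<open>2m\<close> real
  coordinates \<open>d e $ k\<close>.\<close>

definition direction_space :: "'e set \<Rightarrow> ('e \<Rightarrow> real^2) set" where
  "direction_space E = E \<rightarrow>\<^sub>E UNIV"

inductive direction_polynomial :: "'e set \<Rightarrow> (('e \<Rightarrow> real^2) \<Rightarrow> real) \<Rightarrow> bool" for E where
  const: "direction_polynomial E (\<lambda>d. c)"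
| coord: "e \<in> E \<Longrightarrow> direction_polynomial E (\<lambda>d. d e $ k)"
| add: "direction_polynomial E f \<Longrightarrow> direction_polynomial E g \<Longrightarrow>
          direction_polynomial E (\<lambda>d. f d + g d)"
| mult: "direction_polynomial E f \<Longrightarrow> direction_polynomial E g \<Longrightarrow>
          direction_polynomial E (\<lambda>d. f d * g d)"

definition algebraic_subset :: "'e set \<Rightarrow> ('e \<Rightarrow> real^2) set \<Rightarrow> bool" where
  "algebraic_subset E X \<longleftrightarrow>
     (\<exists>P. finite P \<and> (\<forall>f\<in>P. direction_polynomial E f) \<and>
          X = {d \<in> direction_space E. \<forall>f\<in>P. f d = 0})"

end

theory Submission
  imports Defs "HOL-Analysis.Finite_Function_Topology"
begin

text \<open>
  A realization of the quotient is a linear map \<open>x\<close> from \<open>\<real>\<^sup>V \<times> \<real>\<^sup>2\<close> to \<open>\<real>\<^sup>2\<close>, and an edge \<open>ij\<close>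
  asks that \<open>x\<close> sends \<open>w = (e\<^sub>j - e\<^sub>i, \<gamma>)\<close> to a multiple of its direction. The vectors of a
  subgraph have rank \<open>r = n' - c' + rk\<close>, so the sparsity condition reads \<open>m' \<le> 2 r - 1\<close>.

  By Edmonds' covering theorem, edges with \<open>m' \<le> 2 r\<close> for all subgraphs split into two sets of
  linearly independent vectors; giving one part a vertical and the other a horizontal direction
  makes the edge equations independent, hence they are independent for generic directions.
  In the colored-Laman case this remains true when any one edge is doubled, so any nontrivial
  solution has no collapsed edge and solutions form a line up to translation. If the sparsity
  condition fails, a minimal violating subgraph has \<open>m' = 2 r\<close> and is generically collapsed by every
  realization; if there are at most \<open>2 n\<close> edges, a faithful realization can be perturbed.
\<close>

section \<open>Rank of finite families of vectors\<close>

text \<open>The doubled edge comes from a count of unknowns. A pair \<open>(p, L)\<close> has 2(n +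
  2) coordinates, two of which are translations, so 2n + 1 independent edge equations leave only a
  line of scalings. An edge with nonzero direction already contributes one scalar equation; asking
  that it collapse adds a second equation on the same vector, so the enlarged system of 2n + 2
  equations belongs to the edge set with that edge counted twice. The bound 2 r - 1 instead of 2 r
  is exactly the room for this second copy. That the enlarged system has only trivial solutions
  rules out collapsed edges, and applied to \<open>p' - l p\<close> it also gives uniqueness.

  The vertical and horizontal directions decouple the two coordinates of \<open>x\<close>: each part
  of the cover is a basis and kills one coordinate. This certifies a trivial kernel at one
  assignment only, and the assignment depends on the doubled edge. The pivots of an elimination turn
  each certificate into a polynomial that is nonzero somewhere, and the finitely many polynomials
  are multiplied.\<close>

lemma dim_mono_finite:
  fixes S T :: "'a::real_vector set"
  assumes "S \<subseteq> span T" "finite T"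
  shows "dim S \<le> dim T"
proof -
  obtain B where B: "B \<subseteq> S" "independent B" "S \<subseteq> span B" "card B = dim S"
    using basis_exists by blast
  obtain C where C: "C \<subseteq> T" "independent C" "T \<subseteq> span C" "card C = dim T"
    using basis_exists by blast
  have "finite C" using C assms finite_subset by blast
  moreover have "span T \<subseteq> span C" using C(3) by (simp add: span_minimal)
  ultimately show ?thesis
    using independent_span_bound[of C B] B C assms by auto
qed

text \<open>Extend a basis \<open>B\<close> of the intersection to a basis \<open>C\<close> of
  \<open>S\<close> and then to a basis \<open>D\<close> of the union. The vectors added last lie in
  \<open>T\<close>, so together with \<open>B\<close> they form an independent subset of
  \<open>T\<close>.\<close>

lemma dim_Un_Int_le:
  fixes S T :: "'a::real_vector set"
  assumes "finite S" "finite T"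
  shows "dim (S \<union> T) + dim (S \<inter> T) \<le> dim S + dim T"
proof -
  obtain B where B: "B \<subseteq> S \<inter> T" "independent B" "S \<inter> T \<subseteq> span B"
    using maximal_independent_subset by blast
  obtain C where C: "B \<subseteq> C" "C \<subseteq> S" "independent C" "S \<subseteq> span C"
    using maximal_independent_subset_extend[of B S] B by auto
  obtain D where D: "C \<subseteq> D" "D \<subseteq> S \<union> T" "independent D" "S \<union> T \<subseteq> span D"
    using maximal_independent_subset_extend[of C "S \<union> T"] C by auto
  have fin: "finite D" using D assms finite_subset by blast
  then have finC: "finite C" by (rule finite_subset[OF D(1)])
  then have finB: "finite B" by (rule finite_subset[OF C(1)])
  let ?K = "B \<union> (D - C)"
  have KT: "?K \<subseteq> T"
  proof -
    have "d \<in> T" if "d \<in> D - C" for d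
    proof (rule ccontr)
      assume "d \<notin> T"
      then have "d \<in> S" using that D by auto
      then have "d \<in> span C" using C by auto
      then have "d \<in> span (D - {d})"
        using that C D span_mono[of C "D - {d}"] by auto
      then show False using D(3) that dependent_def by blast
    qed
    then show ?thesis using B by auto
  qed
  have "independent ?K" by (rule independent_mono[OF D(3)]) (use C D in auto)
  then have "card ?K \<le> dim T"
    using dim_mono_finite[OF order_trans[OF KT span_superset] assms(2)]
    by (simp add: dim_eq_card_independent)
  moreover have "card ?K = card B + (card D - card C)"
    using C D fin finB finC by (subst card_Un_disjoint) (auto simp: card_Diff_subset)
  moreover have "dim (S \<inter> T) = card B" "dim S = card C" "dim (S \<union> T) = card D"
    using basis_card_eq_dim[OF B(1,3,2)] basis_card_eq_dim[OF C(2,4,3)] basis_card_eq_dim[OF D(2,4,3)]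
    by simp_all
  moreover have "card C \<le> card D" using D fin card_mono by blast
  ultimately show ?thesis by linarith
qed

text \<open>Indexed by edges and not by vectors, since distinct edges may have equal vectors. Such
  edges must count as dependent.\<close>

definition family_rank :: "('e \<Rightarrow> 'a::real_vector) \<Rightarrow> 'e set \<Rightarrow> nat" where
  "family_rank w F = dim (w ` F)"

lemma family_rank_mono: "finite F' \<Longrightarrow> F \<subseteq> F' \<Longrightarrow> family_rank w F \<le> family_rank w F'"
  unfolding family_rank_def by (rule dim_mono_finite) (auto intro: span_base)

lemma family_rank_le_card: "finite F \<Longrightarrow> family_rank w F \<le> card F"
  unfolding family_rank_def
  by (meson card_image_le dim_le_card finite_imageI le_trans span_superset)

text \<open>Without injectivity of \<open>w\<close> the image of an intersection may be smaller than
  the intersection of the images, which only helps the inequality.\<close>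

lemma family_rank_submodular:
  assumes "finite F" "finite F'"
  shows "family_rank w (F \<union> F') + family_rank w (F \<inter> F') \<le> family_rank w F + family_rank w F'"
proof -
  have "family_rank w (F \<inter> F') \<le> dim (w ` F \<inter> w ` F')"
    unfolding family_rank_def using assms
    by (intro dim_mono_finite) (auto intro: span_base)
  then show ?thesis
    using dim_Un_Int_le[of "w ` F" "w ` F'"] assms
    by (simp add: family_rank_def image_Un)
qed

text \<open>Equality of rank and cardinality is the matroid form of independence used below. It
  excludes repeated vectors too, because the rank is at most the size of the image.\<close>

lemma family_rank_eq_card_imp:
  assumes "finite F" "family_rank w F = card F"
  shows "inj_on w F" "independent (w ` F)"
proof -
  obtain B where B: "B \<subseteq> w ` F" "independent B" "w ` F \<subseteq> span B" "card B = dim (w ` F)"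
    using basis_exists by blast
  have "card F \<le> card (w ` F)"
    using assms B card_mono[of "w ` F" B] by (simp add: family_rank_def)
  then show "inj_on w F" using assms(1) card_image_le[of F w] by (intro eq_card_imp_inj_on) auto
  have "B = w ` F"
    using B assms card_image_le[of F w] by (intro card_seteq) (auto simp: family_rank_def)
  then show "independent (w ` F)" using B by simp
qed

lemma span_eq_if_full_rank:
  assumes "finite F" "A \<subseteq> F" "family_rank w A = card A" "card A = family_rank w F"
  shows "span (w ` A) = span (w ` F)"
proof -
  have fA: "finite A" using assms finite_subset by blast
  note A = family_rank_eq_card_imp[OF fA assms(3)]
  have "w ` F \<subseteq> span (w ` A)"
  proof (rule ccontr)
    assume "\<not> ?thesis"
    then obtain b where b: "b \<in> w ` F" "b \<notin> span (w ` A)" by auto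
    have i: "independent (insert b (w ` A))" using A b by (simp add: independent_insertI)
    have "dim (insert b (w ` A)) \<le> dim (w ` F)"
      using b assms by (intro dim_mono_finite) (auto intro: span_base)
    moreover have "dim (insert b (w ` A)) = Suc (card A)"
      using i A(1) b(2) fA span_base[of b "w ` A"]
      by (subst dim_eq_card_independent) (auto simp: card_image card_insert_if)
    ultimately show False using assms by (simp add: family_rank_def)
  qed
  then have "span (w ` F) \<subseteq> span (w ` A)" by (simp add: span_minimal)
  then show ?thesis using assms(2) by (meson image_mono span_mono subset_antisym)
qed

section \<open>Covering a matroid by two independent sets\<close>

text \<open>Shrink a pair of sets \<open>A\<close>, \<open>B\<close>, starting from \<open>A = B = E\<close>, keeping
  \<open>r (A \<inter> F) + r (B \<inter> F) \<ge> card F + card (F \<inter> Z)\<close> for all \<open>F\<close>. An element of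
  \<open>A \<inter> B - Z\<close> can be dropped from \<open>A\<close> or from \<open>B\<close>: two obstructing sets \<open>F1\<close>, \<open>F2\<close>
  would by submodularity contradict the invariant for \<open>F1 \<union> F2\<close> and \<open>F1 \<inter> F2 - {e}\<close>.\<close>

lemma two_independent_sets_shrink:
  fixes r :: "'e set \<Rightarrow> nat"
  assumes fin: "finite E"
    and sub: "\<And>F F'. F \<subseteq> E \<Longrightarrow> F' \<subseteq> E \<Longrightarrow> r (F \<union> F') + r (F \<inter> F') \<le> r F + r F'"
    and Z: "Z \<subseteq> A" "Z \<subseteq> B" and AB: "A \<union> B = E"
    and inv: "\<And>F. F \<subseteq> E \<Longrightarrow> card F + card (F \<inter> Z) \<le> r (A \<inter> F) + r (B \<inter> F)"
  shows "\<exists>A B. A \<union> B = E \<and> A \<inter> B = Z \<and>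
    (\<forall>F\<subseteq>E. card F + card (F \<inter> Z) \<le> r (A \<inter> F) + r (B \<inter> F))"
  using Z AB inv
proof (induction "card (A \<inter> B - Z)" arbitrary: A B rule: less_induct)
  case less
  note inv = less.prems(4)
  have fAB: "finite A" "finite B" using fin less.prems(3) finite_subset by blast+
  show ?case
  proof (cases "A \<inter> B - Z = {}")
    case True
    then have "A \<inter> B = Z" using less.prems by auto
    then show ?thesis using less.prems by blast
  next
    case False
    then obtain e where e: "e \<in> A" "e \<in> B" "e \<notin> Z" by auto
    have fABZ: "finite (A \<inter> B - Z)" using fAB by simp
    have "(\<forall>F\<subseteq>E. card F + card (F \<inter> Z) \<le> r ((A - {e}) \<inter> F) + r (B \<inter> F)) \<or>
          (\<forall>F\<subseteq>E. card F + card (F \<inter> Z) \<le> r (A \<inter> F) + r ((B - {e}) \<inter> F))"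
    proof (rule ccontr)
      assume "\<not> ?thesis"
      then obtain F1 F2 where F1: "F1 \<subseteq> E" "r ((A - {e}) \<inter> F1) + r (B \<inter> F1) < card F1 + card (F1 \<inter> Z)"
        and F2: "F2 \<subseteq> E" "r (A \<inter> F2) + r ((B - {e}) \<inter> F2) < card F2 + card (F2 \<inter> Z)"
        by (meson not_le)
      have e1: "e \<in> F1"
      proof (rule ccontr)
        assume "e \<notin> F1"
        then have "(A - {e}) \<inter> F1 = A \<inter> F1" by auto
        then show False using F1 inv[of F1] by simp
      qed
      have e2: "e \<in> F2"
      proof (rule ccontr)
        assume "e \<notin> F2"
        then have "(B - {e}) \<inter> F2 = B \<inter> F2" by auto
        then show False using F2 inv[of F2] by simp
      qed
      have fF: "finite F1" "finite F2" using F1 F2 fin finite_subset by blast+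
      \<comment> \<open>Submodularity on the \<open>A\<close> side and on the \<open>B\<close> side
        produces the same pair of sets, since \<open>e\<close> has been removed once on each side.
        Dropping \<open>e\<close> from the intersection lowers the count by 1, whereas the two
        strict inequalities lose 2. The terms with \<open>Z\<close> are unaffected because
        \<open>e\<close> is not in \<open>Z\<close>.\<close>
      let ?U = "F1 \<union> F2" and ?I = "F1 \<inter> F2 - {e}"
      have "((A - {e}) \<inter> F1) \<union> (A \<inter> F2) = A \<inter> ?U" "((A - {e}) \<inter> F1) \<inter> (A \<inter> F2) = A \<inter> ?I"
        using e e2 by auto
      then have "r (A \<inter> ?U) + r (A \<inter> ?I) \<le> r ((A - {e}) \<inter> F1) + r (A \<inter> F2)"
        using sub[of "(A - {e}) \<inter> F1" "A \<inter> F2"] F1 F2 by (simp add: le_infI2)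
      moreover have "(B \<inter> F1) \<union> ((B - {e}) \<inter> F2) = B \<inter> ?U" "(B \<inter> F1) \<inter> ((B - {e}) \<inter> F2) = B \<inter> ?I"
        using e e1 by auto
      then have "r (B \<inter> ?U) + r (B \<inter> ?I) \<le> r (B \<inter> F1) + r ((B - {e}) \<inter> F2)"
        using sub[of "B \<inter> F1" "(B - {e}) \<inter> F2"] F1 F2 by (simp add: le_infI2)
      moreover have "card ?U + card (?U \<inter> Z) \<le> r (A \<inter> ?U) + r (B \<inter> ?U)"
        using inv[of ?U] F1 F2 by auto
      moreover have "card ?I + card (?I \<inter> Z) \<le> r (A \<inter> ?I) + r (B \<inter> ?I)"
        using inv[of ?I] F1 F2 by auto
      moreover have "card ?I + 1 = card (F1 \<inter> F2)"
        using e1 e2 fF by (simp add: card_Diff_singleton card_gt_0_iff) 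
           (metis IntI One_nat_def Suc_pred' card_gt_0_iff empty_iff finite_Int)
      moreover have "card ?U + card (F1 \<inter> F2) = card F1 + card F2"
        using fF card_Un_Int by metis
      moreover have "card (?U \<inter> Z) + card (?I \<inter> Z) = card (F1 \<inter> Z) + card (F2 \<inter> Z)"
      proof -
        have "?U \<inter> Z = (F1 \<inter> Z) \<union> (F2 \<inter> Z)" "?I \<inter> Z = (F1 \<inter> Z) \<inter> (F2 \<inter> Z)" using e by auto
        then show ?thesis using fF card_Un_Int[of "F1 \<inter> Z" "F2 \<inter> Z"] by simp
      qed
      ultimately show False using F1(2) F2(2) by linarith
    qed
    then show ?thesis
    proof
      assume a: "\<forall>F\<subseteq>E. card F + card (F \<inter> Z) \<le> r ((A - {e}) \<inter> F) + r (B \<inter> F)"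
      have "card ((A - {e}) \<inter> B - Z) < card (A \<inter> B - Z)"
        by (rule psubset_card_mono[OF fABZ]) (use e in auto)
      then show ?thesis
      proof (rule less.hyps)
        show "A - {e} \<union> B = E" using less.prems(3) e by auto
      qed (use less.prems e a in auto)
    next
      assume a: "\<forall>F\<subseteq>E. card F + card (F \<inter> Z) \<le> r (A \<inter> F) + r ((B - {e}) \<inter> F)"
      have "card (A \<inter> (B - {e}) - Z) < card (A \<inter> B - Z)"
        by (rule psubset_card_mono[OF fABZ]) (use e in auto)
      then show ?thesis
      proof (rule less.hyps)
        show "A \<union> (B - {e}) = E" using less.prems(3) e by auto
      qed (use less.prems e a in auto)
    qed
  qed
qed

text \<open>\<open>count\<close> is Edmonds' condition for \<open>E\<close> with the elements of
  \<open>Z\<close> doubled, and \<open>A \<inter> B = Z\<close> means that these are covered twice.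
  Independence of the final \<open>A\<close> follows from the invariant for \<open>F = A\<close>:
  there the set \<open>B\<close> contributes only \<open>r Z\<close>, which is at most
  \<open>card Z\<close>; likewise for \<open>B\<close>.\<close>

lemma two_independent_sets_cover:
  fixes r :: "'e set \<Rightarrow> nat"
  assumes fin: "finite E"
    and sub: "\<And>F F'. F \<subseteq> E \<Longrightarrow> F' \<subseteq> E \<Longrightarrow> r (F \<union> F') + r (F \<inter> F') \<le> r F + r F'"
    and le_card: "\<And>F. F \<subseteq> E \<Longrightarrow> r F \<le> card F"
    and Z: "Z \<subseteq> E"
    and count: "\<And>F. F \<subseteq> E \<Longrightarrow> card F + card (F \<inter> Z) \<le> 2 * r F"
  shows "\<exists>A B. A \<union> B = E \<and> A \<inter> B = Z \<and> r A = card A \<and> r B = card B"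
proof -
  have "\<And>F. F \<subseteq> E \<Longrightarrow> card F + card (F \<inter> Z) \<le> r (E \<inter> F) + r (E \<inter> F)"
    using count by (simp add: inf_absorb2 mult_2)
  then obtain A B where AB: "A \<union> B = E" "A \<inter> B = Z"
    and inv: "\<forall>F\<subseteq>E. card F + card (F \<inter> Z) \<le> r (A \<inter> F) + r (B \<inter> F)"
    using two_independent_sets_shrink[of E r Z E E] fin sub Z by auto
  have "A \<inter> Z = Z" "B \<inter> Z = Z" "B \<inter> A = Z" using AB by auto
  then have "card A \<le> r A" "card B \<le> r B"
    using inv[rule_format, of A] inv[rule_format, of B] AB le_card[OF Z] by auto
  then show ?thesis using AB le_card[of A] le_card[of B] by (metis Un_upper1 Un_upper2 le_antisym)
qed

section \<open>Linear systems with polynomial coefficients\<close>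

text \<open>Elimination of one unknown per equation. The index sets are arbitrary finite sets
  because the unknowns will be coordinates of vertices together with entries of a matrix.\<close>

lemma exists_nonzero_solution:
  fixes a :: "'i \<Rightarrow> 'u \<Rightarrow> real"
  assumes "finite I" "finite U" "card I < card U"
  shows "\<exists>x. (\<exists>u\<in>U. x u \<noteq> 0) \<and> (\<forall>i\<in>I. (\<Sum>u\<in>U. a i u * x u) = 0)"
  using assms
proof (induction I arbitrary: U a rule: finite_induct)
  case empty
  then obtain u where "u \<in> U" by fastforce
  then show ?case by (intro exI[of _ "\<lambda>_. 1"]) auto
next
  case (insert i I)
  show ?case
  proof (cases "\<forall>u\<in>U. a i u = 0")
    case True
    have "card I < card U" using insert by simp
    then obtain x where "\<exists>u\<in>U. x u \<noteq> 0" "\<forall>i\<in>I. (\<Sum>u\<in>U. a i u * x u) = 0"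
      using insert.IH[of U a] insert.prems by blast
    then show ?thesis using True by (intro exI[of _ x]) auto
  next
    case False
    then obtain v where v: "v \<in> U" "a i v \<noteq> 0" by auto
    let ?U = "U - {v}"
    define b where "b = (\<lambda>j u. a j u - a j v * a i u / a i v)"
    have "card I < card ?U" using insert v by (simp add: card_Diff_singleton)
    then obtain x where x: "\<exists>u\<in>?U. x u \<noteq> 0" "\<forall>j\<in>I. (\<Sum>u\<in>?U. b j u * x u) = 0"
      using insert.IH[of ?U b] insert.prems by auto
    define y where "y = x(v := - (\<Sum>u\<in>?U. a i u * x u) / a i v)"
    have yv: "y v = - (\<Sum>u\<in>?U. a i u * x u) / a i v" by (simp add: y_def)
    have split: "(\<Sum>u\<in>U. a j u * y u) = a j v * y v + (\<Sum>u\<in>?U. a j u * x u)" for j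
    proof -
      have "(\<Sum>u\<in>?U. a j u * y u) = (\<Sum>u\<in>?U. a j u * x u)"
        by (rule sum.cong) (auto simp: y_def)
      then show ?thesis using insert.prems v by (simp add: sum.remove[of U v])
    qed
    have "(\<Sum>u\<in>U. a j u * y u) = 0" if "j \<in> I" for j
    proof -
      have "0 = (\<Sum>u\<in>?U. b j u * x u)" using x that by simp
      also have "\<dots> = (\<Sum>u\<in>?U. a j u * x u) - a j v * (\<Sum>u\<in>?U. a i u * x u) / a i v"
        by (simp add: b_def algebra_simps sum_subtractf sum_distrib_left sum_divide_distrib)
      finally show ?thesis by (simp add: split yv)
    qed
    moreover have "(\<Sum>u\<in>U. a i u * y u) = 0" using v by (simp add: split yv)
    moreover have "\<exists>u\<in>U. y u \<noteq> 0" using x by (auto simp: y_def)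
    ultimately show ?thesis by (intro exI[of _ y]) auto
  qed
qed

section \<open>Polynomials in the coordinates of the directions\<close>

lemma direction_polynomial_uminus:
  "direction_polynomial E f \<Longrightarrow> direction_polynomial E (\<lambda>d. - f d)"
  using direction_polynomial.mult[OF direction_polynomial.const[of E "-1"], of f] by simp

lemma direction_polynomial_diff:
  "direction_polynomial E f \<Longrightarrow> direction_polynomial E g \<Longrightarrow> direction_polynomial E (\<lambda>d. f d - g d)"
  using direction_polynomial.add[OF _ direction_polynomial_uminus, of E f g] by simp

lemma direction_polynomial_cong:
  assumes "direction_polynomial E f" "\<And>e. e \<in> E \<Longrightarrow> d e = d' e"
  shows "f d = f d'"
  using assms by induction auto

lemma direction_polynomial_on_line:
  assumes "direction_polynomial E f"
  shows "\<exists>q. \<forall>t. f (\<lambda>e. a e + t *\<^sub>R b e) = poly q t"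
  using assms
proof induction
  case (const c)
  then show ?case by (intro exI[of _ "[:c:]"]) simp
next
  case (coord e k)
  then show ?case by (intro exI[of _ "[:a e $ k, b e $ k:]"]) simp
next
  case (add f g)
  then show ?case by (metis poly_add)
next
  case (mult f g)
  then show ?case by (metis poly_mult)
qed

text \<open>Restricted to the line through \<open>a\<close> and \<open>b\<close> both functions are
  polynomials in one variable, the first nonzero at 0 and the second at 1. Their product is
  therefore not the zero polynomial, so it has a nonzero value.\<close>

lemma direction_polynomial_common_nonzero:
  assumes "direction_polynomial E f" "direction_polynomial E g" "f a \<noteq> 0" "g b \<noteq> 0"
  shows "\<exists>d. f d * g d \<noteq> 0"
proof -
  let ?l = "\<lambda>t e. a e + t *\<^sub>R (b e - a e)"
  obtain q where q: "\<And>t. f (?l t) = poly q t"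
    using direction_polynomial_on_line[OF assms(1), of a "\<lambda>e. b e - a e"] by auto
  obtain s where s: "\<And>t. g (?l t) = poly s t"
    using direction_polynomial_on_line[OF assms(2), of a "\<lambda>e. b e - a e"] by auto
  have "poly q 0 \<noteq> 0" "poly s 1 \<noteq> 0" using q[of 0] s[of 1] assms by auto
  then have "q * s \<noteq> 0" by auto
  then obtain t where "poly (q * s) t \<noteq> 0" using poly_all_0_iff_0 by blast
  then show ?thesis using q[of t] s[of t] by (intro exI[of _ "?l t"]) simp
qed

lemma direction_polynomial_prod:
  assumes "finite I" "\<And>i. i \<in> I \<Longrightarrow> direction_polynomial E (f i)"
    and "\<And>i. i \<in> I \<Longrightarrow> \<exists>d. f i d \<noteq> 0"
  shows "direction_polynomial E (\<lambda>d. \<Prod>i\<in>I. f i d)" "\<exists>d. (\<Prod>i\<in>I. f i d) \<noteq> 0"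
proof -
  have "direction_polynomial E (\<lambda>d. \<Prod>i\<in>I. f i d) \<and> (\<exists>d. (\<Prod>i\<in>I. f i d) \<noteq> 0)"
    using assms
  proof (induction I rule: finite_induct)
    case empty
    then show ?case by (auto intro: direction_polynomial.const)
  next
    case (insert i I)
    have I: "direction_polynomial E (\<lambda>d. \<Prod>i\<in>I. f i d)" "\<exists>d. (\<Prod>i\<in>I. f i d) \<noteq> 0"
      using insert by auto
    have i: "direction_polynomial E (f i)" "\<exists>d. f i d \<noteq> 0" using insert by auto
    have "\<exists>d. f i d * (\<Prod>i\<in>I. f i d) \<noteq> 0"
      using direction_polynomial_common_nonzero[OF i(1) I(1)] I i by blast
    then show ?case
      using insert.hyps direction_polynomial.mult[OF i(1) I(1)] by simp
  qed
  then show "direction_polynomial E (\<lambda>d. \<Prod>i\<in>I. f i d)" "\<exists>d. (\<Prod>i\<in>I. f i d) \<noteq> 0" by auto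
qed

text \<open>Gaussian elimination over the ring of polynomials; \<open>P\<close> is the product of the pivots,
  which are chosen to be nonzero at \<open>d0\<close>.\<close>

lemma generic_trivial_kernel:
  fixes a :: "'i \<Rightarrow> 'u \<Rightarrow> ('e \<Rightarrow> real^2) \<Rightarrow> real"
  assumes "finite U" "\<And>i u. i \<in> I \<Longrightarrow> u \<in> U \<Longrightarrow> direction_polynomial E (a i u)"
    and "\<And>x. (\<forall>i\<in>I. (\<Sum>u\<in>U. a i u d0 * x u) = 0) \<Longrightarrow> \<forall>u\<in>U. x u = 0"
  shows "\<exists>P. direction_polynomial E P \<and> P d0 \<noteq> 0 \<and>
    (\<forall>d x. P d \<noteq> 0 \<longrightarrow> (\<forall>i\<in>I. (\<Sum>u\<in>U. a i u d * x u) = 0) \<longrightarrow> (\<forall>u\<in>U. x u = 0))"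
  using assms
proof (induction U arbitrary: a rule: finite_induct)
  case empty
  show ?case by (intro exI[of _ "\<lambda>_. 1"]) (auto intro: direction_polynomial.const)
next
  case (insert v U)
  \<comment> \<open>Otherwise the unit vector of \<open>v\<close> would be a nonzero kernel vector
    at \<open>d0\<close>.\<close>
  have "\<exists>i\<in>I. a i v d0 \<noteq> 0"
  proof (rule ccontr)
    assume "\<not> ?thesis"
    then have "\<forall>i\<in>I. (\<Sum>u\<in>insert v U. a i u d0 * (if u = v then 1 else 0)) = 0"
      by (simp add: if_distrib insert.hyps cong: if_cong)
    then have "\<forall>u\<in>insert v U. (if u = v then 1 else 0 :: real) = 0" by (rule insert.prems(2))
    then show False by simp
  qed
  then obtain i where i: "i \<in> I" "a i v d0 \<noteq> 0" by auto
  \<comment> \<open>Cross multiplication in place of division by the pivot keeps the reduced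
    coefficients polynomial.\<close>
  define b where "b = (\<lambda>j u d. a i v d * a j u d - a j v d * a i u d)"
  have b_sum: "(\<Sum>u\<in>U. b j u d * x u)
      = a i v d * (\<Sum>u\<in>U. a j u d * x u) - a j v d * (\<Sum>u\<in>U. a i u d * x u)" for j d x
    by (simp add: b_def algebra_simps sum_subtractf sum_distrib_left)
  have pb: "direction_polynomial E (b j u)" if "j \<in> I" "u \<in> U" for j u
    unfolding b_def using insert.prems(1) i that
    by (intro direction_polynomial_diff direction_polynomial.mult) auto
  have "\<forall>u\<in>U. x u = 0" if x: "\<forall>j\<in>I. (\<Sum>u\<in>U. b j u d0 * x u) = 0" for x
  proof -
    define y where "y = x(v := - (\<Sum>u\<in>U. a i u d0 * x u) / a i v d0)"
    have yv: "a i v d0 * y v = - (\<Sum>u\<in>U. a i u d0 * x u)" using i by (simp add: y_def)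
    have yx: "(\<Sum>u\<in>U. a j u d0 * y u) = (\<Sum>u\<in>U. a j u d0 * x u)" for j
      using insert.hyps by (intro sum.cong) (auto simp: y_def)
    have "(\<Sum>u\<in>insert v U. a j u d0 * y u) = 0" if "j \<in> I" for j
    proof -
      have "a i v d0 * (\<Sum>u\<in>insert v U. a j u d0 * y u)
          = a j v d0 * (a i v d0 * y v) + a i v d0 * (\<Sum>u\<in>U. a j u d0 * x u)"
        using insert.hyps by (simp add: yx distrib_left)
      also have "\<dots> = (\<Sum>u\<in>U. b j u d0 * x u)" by (simp only: yv b_sum)
      finally show ?thesis using x that i by simp
    qed
    then have "\<forall>u\<in>insert v U. y u = 0" using insert.prems(2) by blast
    then show ?thesis using insert.hyps by (metis fun_upd_apply insertCI y_def)
  qed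
  then obtain P where P: "direction_polynomial E P" "P d0 \<noteq> 0"
    "\<And>d x. P d \<noteq> 0 \<Longrightarrow> (\<forall>i\<in>I. (\<Sum>u\<in>U. b i u d * x u) = 0) \<Longrightarrow> (\<forall>u\<in>U. x u = 0)"
    using insert.IH[of b] pb by blast
  have "\<forall>u\<in>insert v U. x u = 0"
    if d: "a i v d * P d \<noteq> 0" and x: "\<forall>j\<in>I. (\<Sum>u\<in>insert v U. a j u d * x u) = 0" for d x
  proof -
    have eq: "(\<Sum>u\<in>U. a j u d * x u) = - a j v d * x v" if "j \<in> I" for j
      using x[rule_format, OF that] insert.hyps by simp
    have "\<forall>j\<in>I. (\<Sum>u\<in>U. b j u d * x u) = 0" using eq i by (simp add: b_sum)
    then have "\<forall>u\<in>U. x u = 0" using P(3)[of d x] d by simp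
    moreover from this have "x v = 0" using eq[OF i(1)] d by simp
    ultimately show ?thesis by simp
  qed
  moreover have "direction_polynomial E (\<lambda>d. a i v d * P d)"
    using P insert.prems(1) i by (intro direction_polynomial.mult) auto
  ultimately show ?case using P i by (intro exI[of _ "\<lambda>d. a i v d * P d"]) auto
qed

text \<open>A linear system in the values of \<open>x\<close> on the basis indexed by
  \<open>A\<close>: every edge gives one equation, and the edges of \<open>Z\<close> are moreover
  collapsed. With vertical directions on \<open>A\<close> and horizontal ones elsewhere, the first
  coordinate of \<open>x\<close> vanishes on \<open>A\<close> and the second on \<open>B\<close>;
  both sets span everything, so the kernel is trivial there and hence generically.\<close>

lemma generic_collapse:
  fixes w :: "'e \<Rightarrow> 'a::real_vector"
  assumes fin: "finite F" and FE: "F \<subseteq> E"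
    and AB: "A \<union> B = F" "A \<inter> B = Z"
    and indep: "family_rank w A = card A" "family_rank w B = card B"
    and full: "card A = family_rank w F" "card B = family_rank w F"
  shows "\<exists>P. direction_polynomial E P \<and> (\<exists>d. P d \<noteq> 0) \<and>
    (\<forall>d x. P d \<noteq> 0 \<longrightarrow> linear x \<longrightarrow> (\<forall>b\<in>F. \<exists>\<alpha>. x (w b) = \<alpha> *\<^sub>R d b) \<longrightarrow>
      (\<forall>z\<in>Z. x (w z) = 0) \<longrightarrow> (\<forall>b\<in>F. x (w b) = (0::real^2)))"
proof -
  have sub: "A \<subseteq> F" "B \<subseteq> F" and finA: "finite A" using AB fin by auto
  note A = family_rank_eq_card_imp[OF finA indep(1)]
  have spA: "span (w ` A) = span (w ` F)" and spB: "span (w ` B) = span (w ` F)"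
    using span_eq_if_full_rank[OF fin sub(1) indep(1) full(1)]
      span_eq_if_full_rank[OF fin sub(2) indep(2) full(2)] by simp_all
  define c where "c = (\<lambda>b a. representation (w ` A) (w b) (w a))"
  have wb: "w b = (\<Sum>a\<in>A. c b a *\<^sub>R w a)" if "b \<in> F" for b
  proof -
    have "w b \<in> span (w ` A)" using that by (simp add: spA span_base)
    then have "w b = (\<Sum>v\<in>w ` A. representation (w ` A) (w b) v *\<^sub>R v)"
      using sum_representation_eq[OF A(2), of "w b" "w ` A"] finA by simp
    then show ?thesis by (simp add: sum.reindex[OF A(1)] c_def o_def)
  qed
  have lin: "f (w b) = (\<Sum>a\<in>A. c b a *\<^sub>R f (w a))" if "linear f" "b \<in> F" for f :: "'a \<Rightarrow> 'c::real_vector" and b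
    by (subst wb[OF that(2)]) (simp add: linear_sum[OF that(1)] linear_scale[OF that(1)])
  \<comment> \<open>\<open>Inl b\<close> stands for the vanishing of the determinant of
    \<open>x (w b)\<close> and \<open>d b\<close>, and \<open>Inr (z, l)\<close> for the vanishing
    of coordinate \<open>l\<close> of \<open>x (w z)\<close>.\<close>
  define I where "I = Inl ` F \<union> Inr ` (Z \<times> (UNIV :: 2 set))"
  define q where "q = (\<lambda>i (a, k) (d :: 'e \<Rightarrow> real^2). case i of
      Inl b \<Rightarrow> c b a * (if k = (1::2) then d b $ 2 else - d b $ 1)
    | Inr (z, l) \<Rightarrow> c z a * (if k = l then 1 else 0))"
  have pairs: "(\<Sum>u\<in>A \<times> UNIV. f u) = (\<Sum>a\<in>A. f (a, 1) + f (a, 2))" for f :: "'e \<times> 2 \<Rightarrow> real"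
    by (simp add: sum.cartesian_product' sum_2)
  have q1: "(\<Sum>u\<in>A \<times> UNIV. q (Inl b) u d * x u)
      = (\<Sum>a\<in>A. c b a * x (a, 1)) * d b $ 2 - (\<Sum>a\<in>A. c b a * x (a, 2)) * d b $ 1" for b d x
    by (simp add: pairs q_def sum_distrib_left sum_subtractf mult_ac)
  have q2: "(\<Sum>u\<in>A \<times> UNIV. q (Inr (z, l)) u d * x u) = (\<Sum>a\<in>A. c z a * x (a, l))" for z l d x
    using exhaust_2[of l] by (auto simp: pairs q_def)
  define d0 where "d0 = (\<lambda>b. if b \<in> A then axis 2 1 else axis 1 1 :: real^2)"
  have "\<exists>P. direction_polynomial E P \<and> P d0 \<noteq> 0 \<and>
    (\<forall>d x. P d \<noteq> 0 \<longrightarrow> (\<forall>i\<in>I. (\<Sum>u\<in>A \<times> UNIV. q i u d * x u) = 0) \<longrightarrow> (\<forall>u\<in>A \<times> UNIV. x u = 0))"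
  proof (rule generic_trivial_kernel)
    show "finite (A \<times> (UNIV :: 2 set))" using finA by simp
    fix i :: "'e + 'e \<times> 2" and u :: "'e \<times> 2"
    assume i: "i \<in> I" and "u \<in> A \<times> UNIV"
    obtain a k where u: "u = (a, k)" by fastforce
    show "direction_polynomial E (q i u)"
    proof (cases i)
      case (Inl b)
      then have "b \<in> E" using i FE by (auto simp: I_def)
      then show ?thesis unfolding q_def u Inl
        by (cases "k = 1") (auto intro!: direction_polynomial.mult direction_polynomial.const
            direction_polynomial.coord direction_polynomial_uminus)
    next
      case (Inr s)
      then show ?thesis unfolding q_def u
        by (cases s) (auto intro!: direction_polynomial.mult direction_polynomial.const)
    qed
  next
    fix x :: "'e \<times> 2 \<Rightarrow> real"
    assume x: "\<forall>i\<in>I. (\<Sum>u\<in>A \<times> UNIV. q i u d0 * x u) = 0"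
    \<comment> \<open>Prescribed values on a basis extend linearly. A numerical solution thus
      becomes a pair of functionals \<open>f 1\<close>, \<open>f 2\<close>, which can also be
      evaluated on the vectors of \<open>B\<close>.\<close>
    have "\<exists>f. linear f \<and> (\<forall>a\<in>A. f (w a) = x (a, k))" for k
    proof -
      obtain f where "linear f" "\<forall>v\<in>w ` A. f v = x (inv_into A w v, k)"
        using linear_independent_extend[OF A(2), of "\<lambda>v. x (inv_into A w v, k)"] by blast
      then show ?thesis using A(1) by (intro exI[of _ f]) (auto simp: inv_into_f_f)
    qed
    then obtain f where f: "\<And>k. linear (f k)" "\<And>k a. a \<in> A \<Longrightarrow> f k (w a) = x (a, k)"
      by metis
    have fs: "(\<Sum>a\<in>A. c b a * x (a, k)) = f k (w b)" if "b \<in> F" for b k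
      using lin[OF f(1) that, of k] f(2) by simp
    have e1: "f 1 (w b) * d0 b $ 2 = f 2 (w b) * d0 b $ 1" if "b \<in> F" for b
      using x[rule_format, of "Inl b"] that by (simp add: q1 fs I_def)
    have e2: "f l (w z) = 0" if "z \<in> Z" for z l
      using x[rule_format, of "Inr (z, l)"] that AB by (auto simp: q2 I_def fs[symmetric])
    have fa: "f 1 (w a) = 0" if "a \<in> A" for a
      using e1[of a] that sub by (auto simp: d0_def axis_def)
    \<comment> \<open>An edge in \<open>A \<inter> B\<close> has the vertical direction and so says
      nothing about \<open>f 2\<close>; the collapse equations on \<open>Z\<close> supply
      this.\<close>
    have fb: "f 2 (w b) = 0" if "b \<in> B" for b
    proof (cases "b \<in> A")
      case True
      then show ?thesis using e2 that AB by auto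
    next
      case False
      then show ?thesis using e1[of b] that sub by (auto simp: d0_def axis_def)
    qed
    have "f 2 v = 0" if "v \<in> span (w ` B)" for v
      by (rule linear_eq_0_on_span[OF f(1) _ that]) (use fb in auto)
    then have fa2: "f 2 (w a) = 0" if "a \<in> A" for a
      using that sub unfolding spB by (auto intro: span_base)
    have "x (a, k) = 0" if "a \<in> A" for a k
      using fa[OF that] fa2[OF that] f(2)[OF that, of k] exhaust_2[of k] by auto
    then show "\<forall>u\<in>A \<times> UNIV. x u = 0" by auto
  qed
  then obtain P where P: "direction_polynomial E P" "P d0 \<noteq> 0"
    "\<And>d x. P d \<noteq> 0 \<Longrightarrow> (\<forall>i\<in>I. (\<Sum>u\<in>A \<times> UNIV. q i u d * x u) = 0) \<Longrightarrow> (\<forall>u\<in>A \<times> UNIV. x u = 0)"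
    by blast
  have "x (w b) = 0" if d: "P d \<noteq> 0" and x: "linear x" "\<forall>b\<in>F. \<exists>\<alpha>. x (w b) = \<alpha> *\<^sub>R d b"
    "\<forall>z\<in>Z. x (w z) = 0" and b: "b \<in> F" for d and x :: "'a \<Rightarrow> real^2" and b
  proof -
    define y where "y = (\<lambda>(a, k). x (w a) $ k)"
    have s: "(\<Sum>a\<in>A. c b a * y (a, k)) = x (w b) $ k" if "b \<in> F" for b k
      by (subst lin[OF x(1) that]) (simp add: y_def sum_component)
    have "(\<Sum>u\<in>A \<times> UNIV. q i u d * y u) = 0" if iI: "i \<in> I" for i
    proof (cases i)
      case (Inl b)
      then have bF: "b \<in> F" using iI by (auto simp: I_def)
      then obtain \<alpha> where "x (w b) = \<alpha> *\<^sub>R d b" using x by blast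
      then show ?thesis using bF by (simp add: Inl q1 s)
    next
      case (Inr t)
      then obtain z l where t: "t = (z, l)" "z \<in> Z" using iI by (auto simp: I_def)
      then have "z \<in> F" using AB by auto
      then show ?thesis using t x by (simp add: Inr q2 s)
    qed
    then have "\<forall>u\<in>A \<times> UNIV. y u = 0" using P(3)[OF d, of y] by blast
    then have "\<forall>a\<in>A. x (w a) = 0" by (auto simp: y_def vec_eq_iff)
    then show ?thesis by (simp add: lin[OF x(1) b])
  qed
  then show ?thesis using P by blast
qed

section \<open>The rank of a subgroup of the integer lattice\<close>

definition real_vec :: "int^2 \<Rightarrow> real^2" where
  "real_vec g = (\<chi> k. real_of_int (g $ k))"

lemma real_vec_simps [simp]:
  "real_vec 0 = 0" "real_vec (g + h) = real_vec g + real_vec h"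
  "real_vec (g - h) = real_vec g - real_vec h" "real_vec (- g) = - real_vec g"
  "real_vec (c *s g) = real_of_int c *\<^sub>R real_vec g" "real_vec g $ k = real_of_int (g $ k)"
  by (simp_all add: real_vec_def vec_eq_iff)

lemma inj_real_vec: "inj real_vec"
  by (auto simp: inj_def vec_eq_iff)

lemma real_vec_sum: "real_vec (sum f A) = (\<Sum>a\<in>A. real_vec (f a))"
  by (induction A rule: infinite_finite_induct) auto

text \<open>In the plane the integral relations can be written down. If \<open>det a b = 0\<close>,
  then \<open>b $ k *s a - a $ k *s b = 0\<close> for both \<open>k\<close>, and any three vectors
  satisfy a relation with determinants as coefficients. An integrally independent set thus has at
  most two elements, and two elements have nonzero determinant.\<close>

lemma int_independent_imp_real_independent:
  assumes fin: "finite B" and indep: "\<not> module.dependent ((*s) :: int \<Rightarrow> int^2 \<Rightarrow> int^2) B"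
  shows "independent (real_vec ` B)"
proof -
  have rel: "u v = 0" if "finite t" "t \<subseteq> B" "(\<Sum>v\<in>t. u v *s v) = 0" "v \<in> t" for t u v
    using indep that unfolding module.dependent_explicit[OF module_int_vec] by blast
  define det :: "int^2 \<Rightarrow> int^2 \<Rightarrow> int" where "det = (\<lambda>a b. a $ 1 * b $ 2 - a $ 2 * b $ 1)"
  have nz: "a \<noteq> 0" if "a \<in> B" for a
    using rel[of "{a}" "\<lambda>_. 1" a] that by auto
  have det: "det a b \<noteq> 0" if "a \<in> B" "b \<in> B" "a \<noteq> b" for a b
  proof
    assume d: "det a b = 0"
    have "b $ k = 0 \<and> a $ k = 0" for k
    proof -
      let ?u = "\<lambda>v. if v = a then b $ k else - a $ k"
      have "(\<Sum>v\<in>{a, b}. ?u v *s v) = 0"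
        using that(3) d exhaust_2[of k] by (auto simp: det_def vec_eq_iff[of _ 0] forall_2 mult.commute)
      then show ?thesis using rel[of "{a, b}" ?u a] rel[of "{a, b}" ?u b] that by auto
    qed
    then have "a = 0" by (simp add: vec_eq_iff)
    then show False using nz that by blast
  qed
  have three: False if "a \<in> B" "b \<in> B" "c \<in> B" "a \<noteq> b" "a \<noteq> c" "b \<noteq> c" for a b c
  proof -
    \<comment> \<open>Cramer's relation:
      \<open>det b c *s a + det c a *s b + det a b *s c = 0\<close>.\<close>
    let ?u = "\<lambda>v. if v = a then det b c else if v = b then det c a else det a b"
    have "(\<Sum>v\<in>{a, b, c}. ?u v *s v) = 0"
      using that by (auto simp: det_def vec_eq_iff forall_2 algebra_simps)
    then have "?u a = 0" by (rule rel[rotated 2]) (use that in auto)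
    then show False using det that by auto
  qed
  have "card B \<le> 2"
  proof (rule ccontr)
    assume "\<not> card B \<le> 2"
    then have "3 \<le> card B" by simp
    then obtain T where T: "T \<subseteq> B" "card T = 3" by (meson obtain_subset_with_card_n)
    then obtain a b c where "T = {a, b, c}" "a \<noteq> b" "a \<noteq> c" "b \<noteq> c"
      unfolding card_3_iff by blast
    then show False using three[of a b c] T by simp
  qed
  then consider "B = {}" | a where "B = {a}" | a b where "B = {a, b}" "a \<noteq> b"
  proof -
    have "card B = 0 \<or> card B = 1 \<or> card B = 2" using \<open>card B \<le> 2\<close> by linarith
    then show thesis using that fin by (auto simp: card_1_singleton_iff card_2_iff)
  qed
  then show ?thesis
  proof cases
    case 2
    then show ?thesis using nz[of a] inj_real_vec by (auto simp: inj_def)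
  next
    case 3
    have "real_vec a \<notin> span {real_vec b}"
    proof
      assume "real_vec a \<in> span {real_vec b}"
      then obtain k where k: "real_vec a = k *\<^sub>R real_vec b" by (auto simp: span_singleton)
      have "real_of_int (a $ i) = k * real_of_int (b $ i)" for i
        using arg_cong[OF k, of "\<lambda>x. x $ i"] by simp
      then have "real_of_int (det a b) = 0" by (simp add: det_def)
      then show False using det 3 by auto
    qed
    moreover have "real_vec b \<noteq> 0" using nz[of b] 3 by (auto simp: vec_eq_iff)
    ultimately show ?thesis using 3 independent_insertI[of "real_vec a" "{real_vec b}"] by simp
  qed (simp add: independent_empty)
qed

lemma real_independent_imp_int_independent:
  assumes "independent (real_vec ` B)"
  shows "\<not> module.dependent ((*s) :: int \<Rightarrow> int^2 \<Rightarrow> int^2) B"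
proof
  assume "module.dependent ((*s) :: int \<Rightarrow> int^2 \<Rightarrow> int^2) B"
  then obtain t u v where t: "finite t" "t \<subseteq> B" "v \<in> t" "u v \<noteq> 0" "(\<Sum>v\<in>t. u v *s v) = 0"
    unfolding module.dependent_explicit[OF module_int_vec] by blast
  have inj: "inj_on real_vec t" using inj_real_vec by (rule inj_on_subset) auto
  let ?u = "\<lambda>x. real_of_int (u (inv real_vec x))"
  have "(\<Sum>x\<in>real_vec ` t. ?u x *\<^sub>R x) = real_vec (\<Sum>v\<in>t. u v *s v)"
    by (simp add: sum.reindex[OF inj] real_vec_sum inv_f_f[OF inj_real_vec])
  then have "(\<Sum>x\<in>real_vec ` t. ?u x *\<^sub>R x) = 0" using t by simp
  moreover have "?u (real_vec v) \<noteq> 0" using t by (simp add: inv_f_f[OF inj_real_vec])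
  ultimately have "dependent (real_vec ` B)"
    unfolding dependent_explicit using t
    by (intro exI[of _ "real_vec ` t"] exI[of _ ?u]) auto
  then show False using assms by simp
qed

lemma group_closure_span: "g \<in> group_closure S \<Longrightarrow> real_vec g \<in> span (real_vec ` S)"
  by (induction rule: group_closure.induct) (auto intro: span_base span_zero span_diff)

text \<open>Independent integral vectors stay independent over the reals and lie in the real span of
  \<open>S\<close>, which bounds the maximum. It is attained because a real basis can be chosen
  among the generators themselves.\<close>

lemma group_rank_group_closure: "group_rank (group_closure S) = dim (real_vec ` S)"
  unfolding group_rank_def
proof (rule Max_eqI)
  let ?C = "{card B |B. finite B \<and> B \<subseteq> group_closure S \<and>
    \<not> module.dependent ((*s) :: int \<Rightarrow> int^2 \<Rightarrow> int^2) B}"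
  show le: "y \<le> dim (real_vec ` S)" if y: "y \<in> ?C" for y
  proof -
    obtain B where B: "y = card B" "finite B" "B \<subseteq> group_closure S"
      "\<not> module.dependent ((*s) :: int \<Rightarrow> int^2 \<Rightarrow> int^2) B" using y by auto
    have "card (real_vec ` B) \<le> dim (span (real_vec ` S))"
      using int_independent_imp_real_independent[OF B(2,4)] group_closure_span B(3)
      by (intro independent_card_le_dim) auto
    moreover have "card (real_vec ` B) = card B"
      using inj_real_vec by (intro card_image) (auto intro: inj_on_subset)
    ultimately show ?thesis using B by simp
  qed
  then show "finite ?C" by (meson finite_nat_set_iff_bounded_le)
  obtain C where C: "C \<subseteq> real_vec ` S" "independent C" "real_vec ` S \<subseteq> span C" "card C = dim (real_vec ` S)"
    using basis_exists by blast
  obtain B where B: "B \<subseteq> S" "C = real_vec ` B" using C(1) by (auto simp: subset_image_iff)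
  have inj: "inj_on real_vec B" using inj_real_vec by (rule inj_on_subset) auto
  have "finite B" using finiteI_independent[OF C(2)] B inj by (simp add: finite_image_iff)
  moreover have "B \<subseteq> group_closure S" using B by (auto intro: group_closure.base)
  moreover have "dim (real_vec ` S) = card B" using C B inj by (simp add: card_image)
  ultimately show "dim (real_vec ` S) \<in> ?C"
    using real_independent_imp_int_independent C(2) B(2) by blast
qed

section \<open>Closed walks\<close>

text \<open>Edges and vertices may repeat, so that walks can be concatenated and reversed freely;
  distinctness is required only of simple cycles.\<close>

fun walk :: "('v, 'e) colored_graph \<Rightarrow> 'e set \<Rightarrow> 'v \<Rightarrow> ('e \<times> bool) list \<Rightarrow> 'v \<Rightarrow> bool" where
  "walk G F u [] v \<longleftrightarrow> u = v"
| "walk G F u (s # C) v \<longleftrightarrow> fst s \<in> F \<and> step_from G s = u \<and> walk G F (step_to G s) C v"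

lemma walk_append: "walk G F u (C @ D) v \<longleftrightarrow> (\<exists>x. walk G F u C x \<and> walk G F x D v)"
  by (induction C arbitrary: u) auto

lemma cycle_color_Nil [simp]: "cycle_color G [] = 0"
  and cycle_color_Cons: "cycle_color G (s # C) =
        (if snd s then color G (fst s) else - color G (fst s)) + cycle_color G C"
  and cycle_color_append: "cycle_color G (C @ D) = cycle_color G C + cycle_color G D"
  by (simp_all add: cycle_color_def)

definition reverse_walk :: "('e \<times> bool) list \<Rightarrow> ('e \<times> bool) list" where
  "reverse_walk C = rev (map (\<lambda>(e, b). (e, \<not> b)) C)"

lemma walk_reverse: "walk G F u C v \<Longrightarrow> walk G F v (reverse_walk C) u"
  by (induction C arbitrary: u)
    (auto simp: reverse_walk_def walk_append step_from_def step_to_def)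

lemma cycle_color_reverse: "cycle_color G (reverse_walk C) = - cycle_color G C"
  by (induction C) (auto simp: reverse_walk_def cycle_color_append cycle_color_Cons)

lemma walk_edges: "walk G F u C v \<Longrightarrow> fst ` set C \<subseteq> F"
  by (induction C arbitrary: u) auto

lemma walk_nth:
  assumes "walk G F u C v" "Suc k < length C"
  shows "step_to G (C ! k) = step_from G (C ! Suc k)"
  using assms
proof (induction C arbitrary: u k)
  case (Cons s C)
  then obtain t D where C: "C = t # D" by (cases C) auto
  show ?case
  proof (cases k)
    case 0
    then show ?thesis using Cons C by auto
  next
    case (Suc j)
    then show ?thesis using Cons by auto
  qed
qed simp

lemma walk_last: "walk G F u C v \<Longrightarrow> C \<noteq> [] \<Longrightarrow> step_to G (last C) = v"
  by (induction C arbitrary: u) auto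

lemma closed_walk_simple_cycle:
  assumes w: "walk G F u C u" and C: "C \<noteq> []"
    and "distinct (map fst C)" "distinct (map (step_from G) C)"
  shows "simple_cycle G F C"
proof -
  have "step_to G (C ! k) = step_from G (C ! (Suc k mod length C))" if "k < length C" for k
  proof (cases "Suc k < length C")
    case True
    then show ?thesis using walk_nth[OF w] by simp
  next
    case False
    then have "k = length C - 1" using that by simp
    then have "step_to G (C ! k) = u" using walk_last[OF w C] C by (simp add: last_conv_nth)
    moreover have "step_from G (C ! 0) = u" using w C by (cases C) auto
    ultimately show ?thesis using \<open>k = length C - 1\<close> C by simp
  qed
  then show ?thesis using assms walk_edges[OF w] by (auto simp: simple_cycle_def)
qed

lemma simple_cycle_closed_walk:
  assumes "simple_cycle G F C"
  shows "\<exists>u. walk G F u C u"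
proof -
  have C: "C \<noteq> []" "fst ` set C \<subseteq> F"
    "\<forall>k < length C. step_to G (C ! k) = step_from G (C ! (Suc k mod length C))"
    using assms by (auto simp: simple_cycle_def)
  \<comment> \<open>Induction over suffixes, starting from the last step: the cyclic index wraps
    around only there, and every earlier step is put in front of a walk already built.\<close>
  have "walk G F (step_from G (C ! (length C - Suc j))) (drop (length C - Suc j) C) (step_from G (C ! 0))"
    if "j < length C" for j
    using that
  proof (induction j)
    case 0
    let ?k = "length C - 1"
    have "drop ?k C = [C ! ?k]"
      using 0 Cons_nth_drop_Suc[of ?k C] by simp
    moreover have "step_to G (C ! ?k) = step_from G (C ! 0)"
      using C(3)[rule_format, of ?k] 0 by simp
    moreover have "fst (C ! ?k) \<in> F" using C(2) 0 by (auto simp: image_subset_iff)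
    ultimately show ?case by simp
  next
    case (Suc j)
    let ?k = "length C - Suc (Suc j)"
    have k: "Suc ?k = length C - Suc j" "?k < length C" using Suc.prems by auto
    have "drop ?k C = C ! ?k # drop (length C - Suc j) C"
      using k(1) Cons_nth_drop_Suc[OF k(2)] by simp
    moreover have "step_to G (C ! ?k) = step_from G (C ! (length C - Suc j))"
      using C(3)[rule_format, of ?k] k Suc.prems by simp
    moreover have "fst (C ! ?k) \<in> F" using C(2) k by (auto simp: image_subset_iff)
    ultimately show ?case using Suc by simp
  qed
  from this[of "length C - 1"] C(1) show ?thesis by auto
qed

text \<open>Induction on the length. A repeated starting vertex splits a closed walk into two
  shorter ones whose colors add up. Distinct starting vertices do not yet give a simple cycle: an
  edge may be traversed back and forth, which is the last case.\<close>

lemma closed_walk_color: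
  assumes "walk G F u C u"
  shows "cycle_color G C \<in> group_closure {cycle_color G C |C. simple_cycle G F C}"
    (is "_ \<in> ?H")
  using assms
proof (induction "length C" arbitrary: u C rule: less_induct)
  case less
  note w = less.prems
  consider "C = []" | "C \<noteq> []" "distinct (map fst C)" "distinct (map (step_from G) C)"
    | "\<not> distinct (map (step_from G) C)"
    | "distinct (map (step_from G) C)" "\<not> distinct (map fst C)" by blast
  then show ?case
  proof cases
    case 1
    then show ?thesis by simp
  next
    case 2
    then have "simple_cycle G F C" by (rule closed_walk_simple_cycle[OF w])
    then show ?thesis by (intro group_closure.base) blast
  next
    case 3
    then obtain xs ys zs y where "map (step_from G) C = xs @ [y] @ ys @ [y] @ zs"
      using not_distinct_decomp by blast
    then obtain X s Y t Z where C: "C = X @ (s # Y) @ (t # Z)" "step_from G s = step_from G t"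
      by (auto simp: map_eq_append_conv map_eq_Cons_conv Cons_eq_map_conv append_eq_map_conv)
    let ?m = "step_from G t"
    have wX: "walk G F u X ?m" and wY: "walk G F ?m (s # Y) ?m" and wZ: "walk G F ?m (t # Z) u"
      using w C by (auto simp: walk_append)
    have "walk G F u (X @ t # Z) u" using wX wZ unfolding walk_append by blast
    then have "cycle_color G (X @ t # Z) \<in> ?H" by (rule less.hyps[rotated]) (simp add: C)
    moreover have "cycle_color G (s # Y) \<in> ?H" by (rule less.hyps[OF _ wY]) (simp add: C)
    ultimately have "cycle_color G (X @ t # Z) + cycle_color G (s # Y) \<in> ?H"
      by (rule group_closure_add)
    then show ?thesis by (simp add: C cycle_color_append cycle_color_Cons algebra_simps)
  next
    case 4
    then obtain xs ys zs y where "map fst C = xs @ [y] @ ys @ [y] @ zs"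
      using not_distinct_decomp by blast
    then obtain X s Y t Z where C: "C = X @ (s # Y) @ (t # Z)" "fst s = fst t"
      by (auto simp: map_eq_append_conv map_eq_Cons_conv Cons_eq_map_conv append_eq_map_conv)
    \<comment> \<open>The same edge left from different vertices is traversed in opposite
      directions. The two traversals cancel in the color; \<open>Y\<close> is closed at the far end
      of \<open>s\<close>, and \<open>X @ Z\<close> closes up without the detour.\<close>
    have "step_from G s \<noteq> step_from G t" using 4(1) C by auto
    then have st: "snd s = (\<not> snd t)" using C(2) by (auto simp: step_from_def split: if_splits)
    then have from_to: "step_to G s = step_from G t" "step_to G t = step_from G s"
      using C(2) by (auto simp: step_from_def step_to_def)
    have wX: "walk G F u X (step_from G s)" and wY: "walk G F (step_to G s) Y (step_to G s)"
      and wZ: "walk G F (step_from G s) Z u"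
      using w C from_to by (auto simp: walk_append)
    have "walk G F u (X @ Z) u" using wX wZ unfolding walk_append by blast
    then have "cycle_color G (X @ Z) \<in> ?H" by (rule less.hyps[rotated]) (simp add: C)
    moreover have "cycle_color G Y \<in> ?H" by (rule less.hyps[OF _ wY]) (simp add: C)
    ultimately have "cycle_color G (X @ Z) + cycle_color G Y \<in> ?H"
      by (rule group_closure_add)
    then show ?thesis using st C(2)
      by (auto simp: C(1) cycle_color_append cycle_color_Cons algebra_simps)
  qed
qed

section \<open>The linear matroid of a colored graph\<close>

text \<open>The incidence vector extended by the color. The first component vanishes for a
  self-loop. Finitely supported functions allow an arbitrary vertex type, so the ambient space may
  have infinite dimension.\<close>

definition edge_vec :: "('v, 'e) colored_graph \<Rightarrow> 'e \<Rightarrow> ('v \<Rightarrow>\<^sub>0 real) \<times> (real^2)" where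
  "edge_vec G e = (Poly_Mapping.single (head G e) 1 - Poly_Mapping.single (tail G e) 1, real_vec (color G e))"

lemma lookup_scaleR [simp]: "Poly_Mapping.lookup (c *\<^sub>R x) v = c *\<^sub>R Poly_Mapping.lookup x v"
proof -
  have "finite {v. c *\<^sub>R Poly_Mapping.lookup x v \<noteq> 0}"
    by (rule finite_subset[of _ "{v. Poly_Mapping.lookup x v \<noteq> 0}"]) auto
  then show ?thesis by (simp add: scaleR_poly_mapping_def Abs_poly_mapping_inverse)
qed

lemma linear_lookup_fst: "linear (\<lambda>x :: ('v \<Rightarrow>\<^sub>0 real) \<times> (real^2). Poly_Mapping.lookup (fst x) v)"
  by (rule linearI) (simp_all add: lookup_add)

text \<open>The vertex parts telescope along the walk. For a closed walk only the color remains,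
  which places all cycle colors in the span.\<close>

lemma walk_vec_in_span:
  fixes G :: "('v, 'e) colored_graph"
  assumes "walk G F u C v"
  shows "(Poly_Mapping.single v 1 - Poly_Mapping.single u 1, real_vec (cycle_color G C)) \<in> span (edge_vec G ` F)"
  using assms
proof (induction C arbitrary: u)
  case Nil
  then show ?case by (simp add: zero_prod_def[symmetric] span_zero)
next
  case (Cons s C)
  let ?g = "if snd s then color G (fst s) else - color G (fst s)"
  let ?x = "(Poly_Mapping.single (step_to G s) 1 - Poly_Mapping.single u 1, real_vec ?g)
    :: ('v \<Rightarrow>\<^sub>0 real) \<times> (real^2)"
  let ?y = "(Poly_Mapping.single v 1 - Poly_Mapping.single (step_to G s) 1, real_vec (cycle_color G C))
    :: ('v \<Rightarrow>\<^sub>0 real) \<times> (real^2)"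
  have e: "edge_vec G (fst s) \<in> span (edge_vec G ` F)" using Cons.prems by (auto intro: span_base)
  have "?x \<in> span (edge_vec G ` F)"
  proof (cases "snd s")
    case True
    then have "?x = edge_vec G (fst s)"
      using Cons.prems by (simp add: edge_vec_def step_from_def step_to_def)
    then show ?thesis using e by (simp only:)
  next
    case False
    then have "?x = - edge_vec G (fst s)"
      using Cons.prems by (auto simp: edge_vec_def step_from_def step_to_def)
    then show ?thesis using span_neg[OF e] by (simp only:)
  qed
  moreover have "?y \<in> span (edge_vec G ` F)" using Cons by simp
  ultimately have "?x + ?y \<in> span (edge_vec G ` F)" by (rule span_add)
  then show ?case by (simp add: cycle_color_Cons)
qed

lemma adjacency_rtrancl_imp_walk:
  assumes "(u, v) \<in> (adjacency G F)\<^sup>*"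
  shows "\<exists>C. walk G F u C v"
  using assms
proof (induction rule: converse_rtrancl_induct)
  case base
  show ?case by (intro exI[of _ "[]"]) simp
next
  case (step x y)
  then obtain C where C: "walk G F y C v" by blast
  obtain e where "e \<in> F" "x = tail G e \<and> y = head G e \<or> x = head G e \<and> y = tail G e"
    using step(1) by (auto simp: adjacency_def)
  then have "\<exists>b. walk G F x ((e, b) # C) v"
    using C by (auto simp: step_from_def step_to_def)
  then show ?case by blast
qed

lemma sym_adjacency_rtrancl: "sym ((adjacency G F)\<^sup>*)"
  by (rule sym_rtrancl) (auto simp: sym_def adjacency_def)

lemma adjacency_rtrancl_class_eq:
  assumes "(u, v) \<in> (adjacency G F)\<^sup>*"
  shows "(adjacency G F)\<^sup>* `` {u} = (adjacency G F)\<^sup>* `` {v}"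
  using assms sym_adjacency_rtrancl[of G F] by (auto simp: sym_def intro: rtrancl_trans)

lemma adjacency_rtrancl_induced_verts:
  assumes "(u, v) \<in> (adjacency G F)\<^sup>*" "u \<in> induced_verts G F"
  shows "v \<in> induced_verts G F"
  using assms by (induction rule: rtrancl_induct) (auto simp: adjacency_def induced_verts_def)

text \<open>The functionals \<open>f v\<close> are dual to the vectors \<open>b v\<close> and vanish
  on \<open>S\<close>, so no \<open>b v\<close> lies in the span of \<open>S\<close> and the other
  vectors.\<close>

lemma independent_insert_by_functionals:
  fixes b :: "'v \<Rightarrow> 'a::real_vector" and f :: "'v \<Rightarrow> 'a \<Rightarrow> real"
  assumes "finite N" "finite S" "independent S" "\<And>v. v \<in> N \<Longrightarrow> linear (f v)"
    and "\<And>v s. v \<in> N \<Longrightarrow> s \<in> S \<Longrightarrow> f v s = 0"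
    and "\<And>v u. v \<in> N \<Longrightarrow> u \<in> N \<Longrightarrow> f v (b u) = (if u = v then 1 else 0)"
  shows "independent (b ` N \<union> S)" "card (b ` N \<union> S) = card N + card S"
proof -
  have "independent (b ` N \<union> S) \<and> card (b ` N \<union> S) = card N + card S"
    using assms
  proof (induction N rule: finite_induct)
    case (insert v N)
    have IH: "independent (b ` N \<union> S)" "card (b ` N \<union> S) = card N + card S"
      using insert by auto
    have z: "f v x = 0" if "x \<in> b ` N \<union> S" for x
      using that insert.prems insert.hyps by auto
    have lin: "linear (f v)" using insert.prems by simp
    have "f v x = 0" if "x \<in> span (b ` N \<union> S)" for x
      by (rule linear_eq_0_on_span[OF lin z that])
    moreover have "f v (b v) = 1" using insert.prems by simp
    ultimately have nin: "b v \<notin> span (b ` N \<union> S)" by force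
    then have "b v \<notin> b ` N \<union> S" by (rule contrapos_nn[OF _ span_base])
    then show ?case using IH insert.hyps insert.prems(1) nin
      by (simp add: independent_insertI card_insert_if)
  qed simp
  then show "independent (b ` N \<union> S)" "card (b ` N \<union> S) = card N + card S" by auto
qed

text \<open>Choose a root in every component and a walk from it to each vertex \<open>v\<close>; a basis of the span
  of the edge vectors consists of the vectors of these walks for the vertices \<open>v\<close> that are not
  roots, together with a basis of the span of the cycle colors.\<close>

lemma family_rank_edge_vec:
  fixes G :: "('v, 'e) colored_graph"
  assumes fin: "finite F"
  shows "family_rank (edge_vec G) F + card (induced_components G F)
    = card (induced_verts G F) + Z2_rank G F"
proof -
  let ?V = "induced_verts G F" and ?R = "(adjacency G F)\<^sup>*"
  let ?S = "span (edge_vec G ` F)"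
  have finV: "finite ?V" using fin by (simp add: induced_verts_def)
  \<comment> \<open>The choice is made from the class of \<open>v\<close>, not from
    \<open>v\<close>, so that all vertices of one component get the same root.\<close>
  define root where "root = (\<lambda>v. SOME u. u \<in> ?R `` {v})"
  have vroot: "(v, root v) \<in> ?R" for v
    unfolding root_def using someI_ex[of "\<lambda>u. u \<in> ?R `` {v}"] by blast
  have rootv: "(root v, v) \<in> ?R" for v
    using vroot sym_adjacency_rtrancl[of G F] by (auto simp: sym_def)
  have root_eq: "root u = root v" if "(u, v) \<in> ?R" for u v
    unfolding root_def adjacency_rtrancl_class_eq[OF that] ..
  have rootV: "root v \<in> ?V" if "v \<in> ?V" for v
    using adjacency_rtrancl_induced_verts[OF vroot that] .
  have root_root: "root (root v) = root v" for v using root_eq[OF rootv] .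
  have "\<exists>W. \<forall>v. walk G F (root v) (W v) v"
    using adjacency_rtrancl_imp_walk[OF rootv] by metis
  then obtain W where W: "\<And>v. walk G F (root v) (W v) v" by blast
  define g where "g = (\<lambda>v. cycle_color G (W v))"
  define b where "b = (\<lambda>v. (Poly_Mapping.single v 1 - Poly_Mapping.single (root v) 1, real_vec (g v))
      :: ('v \<Rightarrow>\<^sub>0 real) \<times> (real^2))"
  define K where "K = real_vec ` {cycle_color G C |C. simple_cycle G F C}"
  have closed: "real_vec (cycle_color G C) \<in> span K" if "walk G F u C u" for u C
    unfolding K_def using closed_walk_color[OF that] by (rule group_closure_span)
  obtain H where H: "H \<subseteq> K" "independent H" "K \<subseteq> span H" "card H = dim K"
    using basis_exists by blast
  have finH: "finite H" using H(2) by (rule finiteI_independent)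
  have spH: "span K = span H" using H by (meson span_minimal span_mono subspace_span subset_antisym)
  define S :: "(('v \<Rightarrow>\<^sub>0 real) \<times> (real^2)) set" where "S = Pair 0 ` H"
  define N where "N = ?V - root ` ?V"
  have lin0: "linear (Pair 0 :: real^2 \<Rightarrow> ('v \<Rightarrow>\<^sub>0 real) \<times> (real^2))" by (rule linearI) simp_all
  have indS: "independent S" unfolding S_def
    by (rule linear_independent_injective_image[OF lin0 H(2)]) (auto simp: inj_on_def)
  have cardS: "card S = card H" unfolding S_def by (rule card_image) (auto simp: inj_on_def)
  have span0: "(0, h) \<in> span (b ` N \<union> S)" if "h \<in> span K" for h
  proof -
    have "(0 :: 'v \<Rightarrow>\<^sub>0 real, h) \<in> span (Pair 0 ` H)"
      using that unfolding spH linear_span_image[OF lin0] by (rule imageI)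
    then show ?thesis unfolding S_def by (rule subsetD[OF span_mono, rotated]) auto
  qed
  have bas: "independent (b ` N \<union> S)" "card (b ` N \<union> S) = card N + card S"
  proof -
    let ?f = "\<lambda>v x. Poly_Mapping.lookup (fst (x :: ('v \<Rightarrow>\<^sub>0 real) \<times> (real^2))) v"
    have f0: "?f v s = 0" if "v \<in> N" "s \<in> S" for v s using that by (auto simp: S_def)
    have fb: "?f v (b u) = (if u = v then 1 else 0)" if "v \<in> N" "u \<in> N" for v u
    proof -
      have "root u \<noteq> v" using that by (auto simp: N_def)
      then show ?thesis by (simp add: b_def lookup_minus lookup_single when_def)
    qed
    have "finite N" "finite S" using finV finH by (auto simp: N_def S_def)
    note * = independent_insert_by_functionals[of N S ?f b, OF this indS linear_lookup_fst f0 fb]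
    show "independent (b ` N \<union> S)" by (rule *)
    show "card (b ` N \<union> S) = card N + card S" by (rule *)
  qed
  have bspan: "b v \<in> span (b ` N \<union> S)" if "v \<in> ?V" for v
  proof (cases "v \<in> N")
    case True
    then show ?thesis by (auto intro: span_base)
  next
    case False
    \<comment> \<open>The walk chosen for a root need not be empty, but it is closed; hence
      \<open>b v\<close> is a pure cycle color.\<close>
    then have rv: "root v = v" using that root_root by (auto simp: N_def)
    then have "real_vec (g v) \<in> span K" unfolding g_def using closed[of v "W v"] W[of v] by simp
    then show ?thesis using span0 rv by (simp add: b_def)
  qed
  have "edge_vec G ` F \<subseteq> span (b ` N \<union> S)"
  proof
    fix x assume "x \<in> edge_vec G ` F"
    then obtain e where e: "e \<in> F" "x = edge_vec G e" by auto
    let ?i = "tail G e" and ?j = "head G e"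
    have V: "?i \<in> ?V" "?j \<in> ?V" using e by (auto simp: induced_verts_def)
    have "(?i, ?j) \<in> ?R" using e by (auto simp: adjacency_def)
    then have r: "root ?i = root ?j" by (rule root_eq)
    \<comment> \<open>The fundamental closed walk of \<open>e\<close>: from the root to the tail,
      along \<open>e\<close>, and back from the head. Its color is the amount by which
      \<open>edge_vec G e\<close> differs from \<open>b ?j - b ?i\<close>.\<close>
    have "walk G F (root ?i) (W ?i @ (e, True) # reverse_walk (W ?j)) (root ?i)"
      using W[of ?i] walk_reverse[OF W[of ?j]] e r
      by (auto simp: walk_append step_from_def step_to_def)
    from closed[OF this] have "real_vec (g ?i + color G e - g ?j) \<in> span K"
      by (simp add: g_def cycle_color_append cycle_color_Cons cycle_color_reverse algebra_simps)
    then have "(0, real_vec (g ?i + color G e - g ?j)) \<in> span (b ` N \<union> S)" by (rule span0)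
    then have "b ?j - b ?i + (0, real_vec (g ?i + color G e - g ?j)) \<in> span (b ` N \<union> S)"
      using bspan V by (intro span_add span_diff)
    moreover have "b ?j - b ?i + (0, real_vec (g ?i + color G e - g ?j)) = x"
      by (simp add: b_def e edge_vec_def r)
    ultimately show "x \<in> span (b ` N \<union> S)" by simp
  qed
  moreover have "b ` N \<union> S \<subseteq> ?S"
  proof -
    have "b v \<in> ?S" for v unfolding b_def g_def by (rule walk_vec_in_span[OF W])
    moreover have "s \<in> ?S" if sS: "s \<in> S" for s
    proof -
      obtain C where C: "simple_cycle G F C" "s = (0, real_vec (cycle_color G C))"
        using sS H(1) by (auto simp: S_def K_def)
      obtain u where "walk G F u C u" using simple_cycle_closed_walk[OF C(1)] by blast
      from walk_vec_in_span[OF this] show ?thesis by (simp add: C(2))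
    qed
    ultimately show ?thesis by auto
  qed
  ultimately have "span (edge_vec G ` F) = span (b ` N \<union> S)"
    by (intro subset_antisym span_minimal subspace_span)
  then have "dim (edge_vec G ` F) = dim (b ` N \<union> S)" by (rule span_eq_dim)
  then have "family_rank (edge_vec G) F = card N + dim K"
    using dim_eq_card_independent[OF bas(1)] bas(2) cardS H(4) by (simp add: family_rank_def)
  moreover have "Z2_rank G F = dim K"
    by (simp add: Z2_rank_def group_rank_group_closure K_def)
  moreover have "card (induced_components G F) = card (root ` ?V)"
  proof -
    let ?pick = "\<lambda>A. SOME u. u \<in> A"
    have "induced_components G F = (\<lambda>v. ?R `` {v}) ` ?V"
      by (auto simp: induced_components_def quotient_def)
    then have "root ` ?V = ?pick ` induced_components G F"
      unfolding root_def by (simp only: image_image)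
    moreover have "inj_on ?pick (induced_components G F)"
    proof (rule inj_onI)
      fix A B assume "A \<in> induced_components G F" "B \<in> induced_components G F" and eq: "?pick A = ?pick B"
      then obtain u v where uv: "A = ?R `` {u}" "B = ?R `` {v}"
        by (auto simp: induced_components_def quotient_def)
      then have "root u = root v" using eq by (simp add: root_def)
      then have "(u, root v) \<in> ?R" using vroot[of u] by simp
      then have "(u, v) \<in> ?R" using rootv[of v] by (rule rtrancl_trans)
      then show "A = B" using uv adjacency_rtrancl_class_eq by simp
    qed
    ultimately show ?thesis by (simp add: card_image)
  qed
  moreover have "card N + card (root ` ?V) = card ?V"
    using card_Diff_subset[of "root ` ?V" ?V] card_mono[OF finV, of "root ` ?V"] finV rootV
    by (simp add: N_def image_subset_iff)
  ultimately show ?thesis by simp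
qed

section \<open>Direction networks on finite colored graphs\<close>

definition displacement ::
  "('v, 'e) colored_graph \<Rightarrow> ('v \<Rightarrow> real^2) \<Rightarrow> real^2^2 \<Rightarrow> 'e \<Rightarrow> real^2" where
  "displacement Q p L e = p (head Q e) + L *v real_vec (color Q e) - p (tail Q e)"

definition faithful_network ::
  "('v, 'e) colored_graph \<Rightarrow> ('e \<Rightarrow> real^2) \<Rightarrow> ('v \<Rightarrow> real^2) \<Rightarrow> real^2^2 \<Rightarrow> bool" where
  "faithful_network Q d p L \<longleftrightarrow>
     (\<forall>e\<in>cedges Q. (\<exists>\<alpha>. displacement Q p L e = \<alpha> *\<^sub>R d e) \<and> displacement Q p L e \<noteq> 0)"

definition unique_network :: "('v, 'e) colored_graph \<Rightarrow> ('e \<Rightarrow> real^2) \<Rightarrow> bool" where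
  "unique_network Q d \<longleftrightarrow>
     (\<exists>p L. faithful_network Q d p L) \<and>
     (\<forall>p L p' L'. faithful_network Q d p L \<and> faithful_network Q d p' L' \<longrightarrow>
        (\<exists>l t. l \<noteq> 0 \<and> (\<forall>v\<in>cverts Q. p' v = l *\<^sub>R p v + t) \<and> L' = l *\<^sub>R L))"

text \<open>Used twice: with a negative factor to subtract a multiple of one realization from
  another, and with a small set of forbidden factors to perturb a faithful one.\<close>

lemma displacement_combination:
  "displacement Q (\<lambda>v. a *\<^sub>R p v + b *\<^sub>R q v + t) (a *\<^sub>R L + b *\<^sub>R M) e
    = a *\<^sub>R displacement Q p L e + b *\<^sub>R displacement Q q M e"
  by (simp add: displacement_def matrix_vector_mult_add_rdistrib scaleR_matrix_vector_assoc[symmetric]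
      algebra_simps)

text \<open>\<open>x \<bullet> perp d\<close> is the determinant of \<open>x\<close> and
  \<open>d\<close>, so that parallelism becomes one linear equation.\<close>

definition perp :: "real^2 \<Rightarrow> real^2" where
  "perp d = (\<chi> k. if k = 1 then d $ 2 else - d $ 1)"

lemma parallel_if_perp_zero:
  assumes "x \<bullet> perp d = 0" "d \<noteq> 0"
  shows "\<exists>\<alpha>. x = \<alpha> *\<^sub>R d"
proof (intro exI[of _ "(x \<bullet> d) / (d \<bullet> d)"])
  have eq: "x $ 1 * d $ 2 = x $ 2 * d $ 1" using assms(1) by (simp add: perp_def inner_vec_def sum_2)
  have dd: "d \<bullet> d \<noteq> 0" using assms(2) by simp
  have "(d \<bullet> d) *\<^sub>R x = (x \<bullet> d) *\<^sub>R d"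
  proof -
    have "(d $ 1 * d $ 1 + d $ 2 * d $ 2) * x $ 1 = (x $ 1 * d $ 1 + x $ 2 * d $ 2) * d $ 1"
      "(d $ 1 * d $ 1 + d $ 2 * d $ 2) * x $ 2 = (x $ 1 * d $ 1 + x $ 2 * d $ 2) * d $ 2"
      using eq by algebra+
    then show ?thesis by (simp add: vec_eq_iff forall_2 inner_vec_def sum_2)
  qed
  then have "inverse (d \<bullet> d) *\<^sub>R (d \<bullet> d) *\<^sub>R x = inverse (d \<bullet> d) *\<^sub>R (x \<bullet> d) *\<^sub>R d" by simp
  then show "x = ((x \<bullet> d) / (d \<bullet> d)) *\<^sub>R d" using dd by (simp add: field_simps)
qed

definition frame_map ::
  "('v, 'e) colored_graph \<Rightarrow> ('v \<Rightarrow> real^2) \<Rightarrow> real^2^2 \<Rightarrow> ('v \<Rightarrow>\<^sub>0 real) \<times> (real^2) \<Rightarrow> real^2" where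
  "frame_map Q p L x = (\<Sum>v\<in>cverts Q. Poly_Mapping.lookup (fst x) v *\<^sub>R p v) + L *v snd x"

lemma linear_frame_map: "linear (frame_map Q p L)"
  by (rule linearI)
    (simp_all add: frame_map_def lookup_add scaleR_left_distrib sum.distrib matrix_vector_right_distrib
      scaleR_sum_right matrix_vector_mult_scaleR scaleR_right_distrib algebra_simps)

section \<open>Full rank and realizations that collapse every edge\<close>

locale finite_colored_graph =
  fixes Q :: "('v, 'e) colored_graph"
  assumes finite_cverts: "finite (cverts Q)" and cverts_nonempty: "cverts Q \<noteq> {}"
    and finite_cedges: "finite (cedges Q)"
    and ends_in_cverts: "\<And>e. e \<in> cedges Q \<Longrightarrow> tail Q e \<in> cverts Q \<and> head Q e \<in> cverts Q"
begin

abbreviation "rk \<equiv> family_rank (edge_vec Q)"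

lemma frame_map_vertex:
  "v \<in> cverts Q \<Longrightarrow> frame_map Q p L (Poly_Mapping.single v 1, 0) = p v"
  using finite_cverts by (simp add: frame_map_def lookup_single when_def if_distrib[of "\<lambda>c. c *\<^sub>R _"] cong: if_cong)

lemma frame_map_edge:
  assumes "e \<in> cedges Q"
  shows "frame_map Q p L (edge_vec Q e) = displacement Q p L e"
proof -
  have split: "edge_vec Q e = (Poly_Mapping.single (head Q e) 1, 0) - (Poly_Mapping.single (tail Q e) 1, 0)
      + (0, real_vec (color Q e))"
    by (simp add: edge_vec_def)
  moreover have "frame_map Q p L (0, h) = L *v h" for h
    by (simp add: frame_map_def)
  ultimately show ?thesis
    using ends_in_cverts[OF assms] unfolding split
    by (simp del: add_Pair diff_Pair add: linear_add[OF linear_frame_map] linear_diff[OF linear_frame_map]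
        frame_map_vertex displacement_def)
qed

definition coordinate_vecs :: "(('v \<Rightarrow>\<^sub>0 real) \<times> (real^2)) set" where
  "coordinate_vecs = (\<lambda>v. (Poly_Mapping.single v 1, 0)) ` cverts Q \<union> range (\<lambda>k. (0, axis k 1))"

lemma coordinate_vecs:
  shows "finite coordinate_vecs" "card coordinate_vecs \<le> card (cverts Q) + 2"
    "edge_vec Q ` cedges Q \<subseteq> span coordinate_vecs"
proof -
  let ?A = "(\<lambda>v. (Poly_Mapping.single v (1::real), 0 :: real^2)) ` cverts Q"
  let ?B = "range (\<lambda>k::2. (0 :: 'v \<Rightarrow>\<^sub>0 real, axis k (1::real)))"
  show "finite coordinate_vecs" using finite_cverts by (simp add: coordinate_vecs_def)
  have "card ?A \<le> card (cverts Q)" using finite_cverts by (rule card_image_le)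
  moreover have "card ?B \<le> 2" using card_image_le[of "UNIV :: 2 set"] by simp
  moreover have "card coordinate_vecs \<le> card ?A + card ?B" unfolding coordinate_vecs_def by (rule card_Un_le)
  ultimately show "card coordinate_vecs \<le> card (cverts Q) + 2" by linarith
  show "edge_vec Q ` cedges Q \<subseteq> span coordinate_vecs"
  proof
    fix x assume "x \<in> edge_vec Q ` cedges Q"
    then obtain e where e: "e \<in> cedges Q" "x = edge_vec Q e" by auto
    let ?g = "real_vec (color Q e)"
    have "x = (Poly_Mapping.single (head Q e) 1, 0) - (Poly_Mapping.single (tail Q e) 1, 0)
      + (?g $ 1) *\<^sub>R (0, axis 1 1) + (?g $ 2) *\<^sub>R (0, axis 2 1)"
      by (simp add: e edge_vec_def vec_eq_iff forall_2 axis_def)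
    moreover have "(Poly_Mapping.single (head Q e) 1, 0) \<in> span coordinate_vecs"
      "(Poly_Mapping.single (tail Q e) 1, 0) \<in> span coordinate_vecs"
      "(0, axis 1 1) \<in> span coordinate_vecs" "(0, axis 2 1) \<in> span coordinate_vecs"
      using ends_in_cverts[OF e(1)] by (auto simp: coordinate_vecs_def intro!: span_base)
    ultimately show "x \<in> span coordinate_vecs" by (simp only:) (intro span_add span_diff span_scale)
  qed
qed

text \<open>Placing all vertices at one nonzero point with \<open>L = 0\<close> gives a linear map
  that kills every edge vector but no vertex vector. This translation is why the rank is at most n +
  1 although the space has n + 2 generators.\<close>

lemma vertex_notin_edge_span:
  assumes "v0 \<in> cverts Q"
  shows "(Poly_Mapping.single v0 1, 0) \<notin> span (edge_vec Q ` cedges Q)"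
proof
  let ?f = "frame_map Q (\<lambda>_. axis 1 1) 0"
  assume "(Poly_Mapping.single v0 1, 0) \<in> span (edge_vec Q ` cedges Q)"
  then have "?f (Poly_Mapping.single v0 1, 0) = 0"
    by (rule linear_eq_0_on_span[OF linear_frame_map, rotated])
      (auto simp: frame_map_edge displacement_def)
  then show False using frame_map_vertex[OF assms, of "\<lambda>_. axis 1 1" 0] by (simp add: axis_eq_0_iff)
qed

lemma edge_basis_with_vertex:
  assumes "v0 \<in> cverts Q"
  obtains T where "independent T" "card T = rk (cedges Q) + 1"
    "T \<subseteq> insert (Poly_Mapping.single v0 1, 0) (edge_vec Q ` cedges Q)"
proof -
  obtain C where C: "C \<subseteq> edge_vec Q ` cedges Q" "independent C"
    "edge_vec Q ` cedges Q \<subseteq> span C" "card C = dim (edge_vec Q ` cedges Q)"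
    using basis_exists by blast
  let ?x = "(Poly_Mapping.single v0 1, 0) :: ('v \<Rightarrow>\<^sub>0 real) \<times> (real^2)"
  have "?x \<notin> span C" using vertex_notin_edge_span[OF assms] span_mono[OF C(1)] by blast
  moreover from this have "?x \<notin> C" by (rule contrapos_nn[OF _ span_base])
  moreover have "finite C" using C(1) finite_cedges by (meson finite_imageI finite_subset)
  ultimately show thesis
    using that[of "insert ?x C"] C by (auto simp: independent_insertI family_rank_def)
qed

lemma rk_le: "rk (cedges Q) \<le> card (cverts Q) + 1"
proof -
  obtain v0 where v0: "v0 \<in> cverts Q" using cverts_nonempty by blast
  obtain T where T: "independent T" "card T = rk (cedges Q) + 1"
    "T \<subseteq> insert (Poly_Mapping.single v0 1, 0) (edge_vec Q ` cedges Q)"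
    using edge_basis_with_vertex[OF v0] by blast
  note D = coordinate_vecs
  have "(Poly_Mapping.single v0 1, 0) \<in> span coordinate_vecs"
    using v0 by (auto simp: coordinate_vecs_def intro: span_base)
  with T(3) D(3) have "T \<subseteq> span coordinate_vecs" by blast
  from independent_span_bound[OF D(1) T(1) this] show ?thesis using D(2) T(2) by linarith
qed

text \<open>At rank n + 1, edge vectors and one vertex vector provide n + 2 independent elements of
  a space with n + 2 generators, so they span it. After translating \<open>v0\<close> to the origin,
  the realization vanishes on all of them.\<close>

lemma collapsed_imp_trivial:
  assumes rank: "rk (cedges Q) = card (cverts Q) + 1" and v0: "v0 \<in> cverts Q"
    and collapsed: "\<forall>e\<in>cedges Q. displacement Q p L e = 0"
  shows "L = 0" "\<And>v. v \<in> cverts Q \<Longrightarrow> p v = p v0"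
proof -
  obtain T where T: "independent T" "card T = rk (cedges Q) + 1"
    "T \<subseteq> insert (Poly_Mapping.single v0 1, 0) (edge_vec Q ` cedges Q)"
    using edge_basis_with_vertex[OF v0] by blast
  note D = coordinate_vecs
  have "(Poly_Mapping.single v0 1, 0) \<in> span coordinate_vecs" using v0 by (auto simp: coordinate_vecs_def intro: span_base)
  with T(3) D(3) have TD: "T \<subseteq> span coordinate_vecs" by blast
  have finT: "finite T" using T(2) card.infinite by force
  have DT: "x \<in> span T" if "x \<in> coordinate_vecs" for x
  proof (rule ccontr)
    assume x: "x \<notin> span T"
    then have "x \<notin> T" by (rule contrapos_nn[OF _ span_base])
    then have "card (insert x T) = card (cverts Q) + 3" using finT T(2) rank by simp
    moreover have "insert x T \<subseteq> span coordinate_vecs" using TD span_base[OF that] by simp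
    ultimately show False
      using independent_span_bound[OF D(1) independent_insertI[OF x T(1)]] D(2) by simp
  qed
  let ?f = "frame_map Q (\<lambda>v. p v - p v0) L"
  have "?f x = 0" if "x \<in> T" for x
  proof -
    have "?f (edge_vec Q e) = 0" if "e \<in> cedges Q" for e
    proof -
      have "displacement Q (\<lambda>v. p v - p v0) L e = displacement Q p L e" by (simp add: displacement_def)
      then show ?thesis using collapsed that by (simp add: frame_map_edge[OF that])
    qed
    moreover have "?f (Poly_Mapping.single v0 1, 0) = 0" by (simp add: frame_map_vertex[OF v0])
    ultimately show ?thesis using that T(3) by auto
  qed
  then have z: "?f x = 0" if "x \<in> coordinate_vecs" for x
    by (rule linear_eq_0_on_span[OF linear_frame_map _ DT[OF that]])
  show "p v = p v0" if "v \<in> cverts Q" for v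
    using z[of "(Poly_Mapping.single v 1, 0)"] that by (simp add: frame_map_vertex coordinate_vecs_def)
  have "L *v axis k 1 = 0" for k
    using z[of "(0, axis k 1)"] by (simp add: frame_map_def coordinate_vecs_def)
  then show "L = 0" by (simp add: vec_eq_iff matrix_vector_mult_basis column_def)
qed

text \<open>With \<open>v0\<close> pinned there remain 2(n - 1) + 4 = 2n + 2 unknowns, one more than
  the equations allowed. The map \<open>\<epsilon>\<close> from indices to edges permits several
  equations on the same edge.\<close>

lemma exists_nonzero_network:
  assumes I: "finite I" "card I \<le> 2 * card (cverts Q) + 1" and v0: "v0 \<in> cverts Q"
    and eps: "\<And>i. i \<in> I \<Longrightarrow> \<epsilon> i \<in> cedges Q"
  shows "\<exists>p L. p v0 = 0 \<and> \<not> ((\<forall>v\<in>cverts Q. p v = 0) \<and> L = 0) \<and>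
    (\<forall>i\<in>I. displacement Q p L (\<epsilon> i) \<bullet> c i = 0)"
proof -
  let ?V = "cverts Q - {v0}"
  let ?U = "(?V <+> (UNIV :: 2 set)) \<times> (UNIV :: 2 set)"
  \<comment> \<open>The coefficients of a displacement as a linear form in the remaining vertices
    (\<open>Inl\<close>) and the columns of \<open>L\<close> (\<open>Inr\<close>).\<close>
  define \<omega> where "\<omega> = (\<lambda>e w. case w of
      Inl v \<Rightarrow> (if v = head Q e then 1 else 0) - (if v = tail Q e then 1 else 0 :: real)
    | Inr l \<Rightarrow> real_vec (color Q e) $ l)"
  have "card ?U = 2 * card (cverts Q) + 2"
  proof -
    have "0 < card (cverts Q)" using v0 finite_cverts by (auto simp: card_gt_0_iff)
    then show ?thesis
      using v0 finite_cverts by (simp add: card_cartesian_product card_Plus card_Diff_singleton)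
  qed
  then have "card I < card ?U" using I by simp
  moreover have "finite ?U" using finite_cverts by simp
  ultimately obtain x where x: "\<exists>u\<in>?U. x u \<noteq> 0"
    "\<forall>i\<in>I. (\<Sum>u\<in>?U. (\<omega> (\<epsilon> i) (fst u) * c i $ snd u) * x u) = 0"
    using exists_nonzero_solution[OF I(1), of ?U "\<lambda>i u. \<omega> (\<epsilon> i) (fst u) * c i $ snd u"] by blast
  define p where "p = (\<lambda>v. if v \<in> ?V then (\<chi> k. x (Inl v, k)) else 0)"
  define L :: "real^2^2" where "L = (\<chi> k l. x (Inr l, k))"
  have disp: "(\<Sum>w\<in>?V <+> UNIV. \<omega> e w * x (w, k)) = displacement Q p L e $ k"
    if "e \<in> cedges Q" for e k
  proof -
    have delta: "(\<Sum>v\<in>?V. (if v = u then 1 else 0) * x (Inl v, k)) = p u $ k" for u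
      using finite_cverts by (simp add: p_def if_distrib[of "\<lambda>c. c * _"] cong: if_cong)
    have "(\<Sum>w\<in>?V <+> UNIV. \<omega> e w * x (w, k))
        = (\<Sum>v\<in>?V. \<omega> e (Inl v) * x (Inl v, k)) + (\<Sum>l\<in>UNIV. \<omega> e (Inr l) * x (Inr l, k))"
      using finite_cverts by (subst sum.Plus) (simp_all add: o_def)
    also have "(\<Sum>v\<in>?V. \<omega> e (Inl v) * x (Inl v, k)) = p (head Q e) $ k - p (tail Q e) $ k"
      by (simp only: \<omega>_def sum.case left_diff_distrib sum_subtractf delta)
    also have "(\<Sum>l\<in>UNIV. \<omega> e (Inr l) * x (Inr l, k)) = (L *v real_vec (color Q e)) $ k"
      by (simp add: \<omega>_def L_def matrix_vector_mult_def mult.commute)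
    finally show ?thesis by (simp add: displacement_def)
  qed
  have "displacement Q p L (\<epsilon> i) \<bullet> c i = 0" if "i \<in> I" for i
  proof -
    have "0 = (\<Sum>u\<in>?U. (\<omega> (\<epsilon> i) (fst u) * c i $ snd u) * x u)" using x that by simp
    also have "\<dots> = (\<Sum>k\<in>UNIV. \<Sum>w\<in>?V <+> UNIV. (\<omega> (\<epsilon> i) w * c i $ k) * x (w, k))"
      by (simp only: sum.cartesian_product' fst_conv snd_conv) (rule sum.swap)
    also have "\<dots> = (\<Sum>k\<in>UNIV. displacement Q p L (\<epsilon> i) $ k * c i $ k)"
      by (simp add: disp[OF eps[OF that], symmetric] sum_distrib_left mult_ac)
    finally show ?thesis by (simp add: inner_vec_def)
  qed
  moreover have "p v0 = 0" by (simp add: p_def)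
  moreover have "\<not> ((\<forall>v\<in>cverts Q. p v = 0) \<and> L = 0)"
  proof
    assume a: "(\<forall>v\<in>cverts Q. p v = 0) \<and> L = 0"
    have "x u = 0" if "u \<in> ?U" for u
    proof (cases u)
      case (Pair w k)
      show ?thesis
      proof (cases w)
        case (Inl v)
        then have v: "v \<in> ?V" using that Pair by auto
        then have "p v $ k = 0" using a by simp
        then show ?thesis using v Pair Inl by (simp add: p_def)
      next
        case (Inr l)
        have "L $ k $ l = 0" using a by simp
        then show ?thesis using Pair Inr by (simp add: L_def)
      qed
    qed
    then show False using x by blast
  qed
  ultimately show ?thesis by blast
qed

lemma colored_Laman_iff:
  "colored_Laman Q \<longleftrightarrow> card (cedges Q) = 2 * card (cverts Q) + 1 \<and>
     (\<forall>F. F \<subseteq> cedges Q \<and> F \<noteq> {} \<longrightarrow> card F + 1 \<le> 2 * rk F)"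
proof -
  have "int (card F) \<le> 2 * int (card (induced_verts Q F)) - 3 + 2 * int (Z2_rank Q F)
                         - 2 * (int (card (induced_components Q F)) - 1)
      \<longleftrightarrow> card F + 1 \<le> 2 * rk F" if "F \<subseteq> cedges Q" for F
  proof -
    have "finite F" using that finite_cedges finite_subset by blast
    from family_rank_edge_vec[OF this, of Q]
    have rank: "int (rk F) + int (card (induced_components Q F))
        = int (card (induced_verts Q F)) + int (Z2_rank Q F)"
      by (simp flip: of_nat_add)
    have "card F + 1 \<le> 2 * rk F \<longleftrightarrow> int (card F) + 1 \<le> 2 * int (rk F)" by linarith
    then show ?thesis using rank by auto
  qed
  then show ?thesis unfolding colored_Laman_def by blast
qed

end

section \<open>Generic direction networks and the sparsity count\<close>

context finite_colored_graph
begin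

text \<open>The two sizes add up to \<open>2 * rk F\<close> and neither exceeds \<open>rk F\<close>,
  so tightness turns the independent sets into bases.\<close>

lemma rk_cover:
  assumes F: "F \<subseteq> cedges Q" and Z: "Z \<subseteq> F"
    and count: "\<And>F'. F' \<subseteq> F \<Longrightarrow> card F' + card (F' \<inter> Z) \<le> 2 * rk F'"
    and tight: "card F + card Z = 2 * rk F"
  shows "\<exists>A B. A \<union> B = F \<and> A \<inter> B = Z \<and> rk A = card A \<and> rk B = card B \<and> card A = rk F \<and> card B = rk F"
proof -
  have fin: "finite F" using F finite_cedges finite_subset by blast
  then have finF': "finite F'" if "F' \<subseteq> F" for F' using that finite_subset by blast
  have "\<exists>A B. A \<union> B = F \<and> A \<inter> B = Z \<and> rk A = card A \<and> rk B = card B"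
    by (rule two_independent_sets_cover[OF fin _ _ Z count])
      (auto intro: family_rank_submodular family_rank_le_card finF')
  then obtain A B where AB: "A \<union> B = F" "A \<inter> B = Z" "rk A = card A" "rk B = card B" by blast
  have sub: "A \<subseteq> F" "B \<subseteq> F" using AB by auto
  have "card A + card B = card F + card Z"
    using card_Un_Int[of A B] AB(1,2) finF'[OF sub(1)] finF'[OF sub(2)] by simp
  moreover have "rk A \<le> rk F" "rk B \<le> rk F" using family_rank_mono[OF fin] sub by blast+
  ultimately have "card A = rk F" "card B = rk F" using AB tight by linarith+
  then show ?thesis using AB by blast
qed

text \<open>Serves both directions of the equivalence: with \<open>Z = {e}\<close> and all edges,
  collapse of \<open>e\<close> spreads to the whole network; with \<open>Z = {}\<close> and a tight
  violating subgraph, every realization collapses that subgraph.\<close>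

lemma generic_collapse_network:
  assumes F: "F \<subseteq> cedges Q" and Z: "Z \<subseteq> F"
    and count: "\<And>F'. F' \<subseteq> F \<Longrightarrow> card F' + card (F' \<inter> Z) \<le> 2 * rk F'"
    and tight: "card F + card Z = 2 * rk F"
  shows "\<exists>P. direction_polynomial (cedges Q) P \<and> (\<exists>d. P d \<noteq> 0) \<and>
    (\<forall>d p L. P d \<noteq> 0 \<longrightarrow> (\<forall>e\<in>F. \<exists>\<alpha>. displacement Q p L e = \<alpha> *\<^sub>R d e) \<longrightarrow>
      (\<forall>e\<in>Z. displacement Q p L e = 0) \<longrightarrow> (\<forall>e\<in>F. displacement Q p L e = 0))"
proof -
  obtain A B where AB: "A \<union> B = F" "A \<inter> B = Z" "rk A = card A" "rk B = card B"
    "card A = rk F" "card B = rk F"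
    using rk_cover[OF assms] by blast
  have fin: "finite F" using F finite_cedges finite_subset by blast
  obtain P where P: "direction_polynomial (cedges Q) P" "\<exists>d. P d \<noteq> 0"
    "\<And>d x. P d \<noteq> 0 \<Longrightarrow> linear x \<Longrightarrow> \<forall>b\<in>F. \<exists>\<alpha>. x (edge_vec Q b) = \<alpha> *\<^sub>R d b \<Longrightarrow>
      \<forall>z\<in>Z. x (edge_vec Q z) = 0 \<Longrightarrow> \<forall>b\<in>F. x (edge_vec Q b) = (0::real^2)"
    using generic_collapse[OF fin F AB] by blast
  have "\<forall>e\<in>F. displacement Q p L e = 0"
    if d: "P d \<noteq> 0" and pL: "\<forall>e\<in>F. \<exists>\<alpha>. displacement Q p L e = \<alpha> *\<^sub>R d e"
      "\<forall>e\<in>Z. displacement Q p L e = 0" for d p L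
  proof -
    have eq: "frame_map Q p L (edge_vec Q e) = displacement Q p L e" if "e \<in> F" for e
      using frame_map_edge F that by blast
    have "\<forall>b\<in>F. frame_map Q p L (edge_vec Q b) = 0"
      by (rule P(3)[OF d linear_frame_map]) (use pL Z in \<open>auto simp: eq subset_iff\<close>)
    then show ?thesis by (simp add: eq)
  qed
  then show ?thesis using P(1,2) by blast
qed

lemma unique_network_if_generic_Laman:
  assumes Laman: "colored_Laman Q"
    and nz: "\<And>e. e \<in> cedges Q \<Longrightarrow> d e \<noteq> 0"
    and collapse: "\<And>p L e. e \<in> cedges Q \<Longrightarrow> \<forall>b\<in>cedges Q. \<exists>\<alpha>. displacement Q p L b = \<alpha> *\<^sub>R d b \<Longrightarrow>
      displacement Q p L e = 0 \<Longrightarrow> \<forall>b\<in>cedges Q. displacement Q p L b = 0"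
  shows "unique_network Q d"
proof -
  have m: "card (cedges Q) = 2 * card (cverts Q) + 1"
    and count: "\<And>F. F \<subseteq> cedges Q \<Longrightarrow> F \<noteq> {} \<Longrightarrow> card F + 1 \<le> 2 * rk F"
    using Laman unfolding colored_Laman_iff by blast+
  obtain v0 where v0: "v0 \<in> cverts Q" using cverts_nonempty by blast
  have "cedges Q \<noteq> {}" using m by force
  \<comment> \<open>The sparsity bound on the whole graph gives 2n + 2 <= 2 rk, and
    \<open>rk_le\<close> is the reverse bound.\<close>
  then have rank: "rk (cedges Q) = card (cverts Q) + 1"
    using count[OF subset_refl] m rk_le by linarith
  obtain e0 where e0: "e0 \<in> cedges Q" using \<open>cedges Q \<noteq> {}\<close> by blast
  have "\<exists>p L. p v0 = 0 \<and> \<not> ((\<forall>v\<in>cverts Q. p v = 0) \<and> L = 0) \<and>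
      (\<forall>e\<in>cedges Q. displacement Q p L e \<bullet> perp (d e) = 0)"
    by (rule exists_nonzero_network[OF finite_cedges _ v0]) (simp_all add: m)
  then obtain p L where pL: "p v0 = 0" "\<not> ((\<forall>v\<in>cverts Q. p v = 0) \<and> L = 0)"
    "\<forall>e\<in>cedges Q. displacement Q p L e \<bullet> perp (d e) = 0" by blast
  have par: "\<forall>b\<in>cedges Q. \<exists>\<alpha>. displacement Q p L b = \<alpha> *\<^sub>R d b"
    using parallel_if_perp_zero nz pL(3) by blast
  have "displacement Q p L e \<noteq> 0" if "e \<in> cedges Q" for e
  proof
    assume "displacement Q p L e = 0"
    then have "\<forall>b\<in>cedges Q. displacement Q p L b = 0" by (rule collapse[OF that par])
    from collapsed_imp_trivial[OF rank v0 this] show False using pL(1,2) by simp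
  qed
  then have ex: "faithful_network Q d p L" using par by (simp add: faithful_network_def)
  have uni: "\<exists>l t. l \<noteq> 0 \<and> (\<forall>v\<in>cverts Q. p' v = l *\<^sub>R p v + t) \<and> L' = l *\<^sub>R L"
    if f: "faithful_network Q d p L" "faithful_network Q d p' L'" for p L p' L'
  proof -
    have factor: "\<exists>a. displacement Q p L e0 = a *\<^sub>R d e0 \<and> a \<noteq> 0"
      if "faithful_network Q d p L" for p L
    proof -
      obtain a where "displacement Q p L e0 = a *\<^sub>R d e0" "displacement Q p L e0 \<noteq> 0"
        using \<open>faithful_network Q d p L\<close> e0 unfolding faithful_network_def by blast
      then show ?thesis by (intro exI[of _ a]) auto
    qed
    obtain a where a: "displacement Q p L e0 = a *\<^sub>R d e0" "a \<noteq> 0" using factor[OF f(1)] by blast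
    obtain a' where a': "displacement Q p' L' e0 = a' *\<^sub>R d e0" "a' \<noteq> 0" using factor[OF f(2)] by blast
    \<comment> \<open>The ratio for which \<open>p' - l p\<close> collapses \<open>e0\<close>, so
      that the collapse property applies to the difference.\<close>
    define l where "l = a' / a"
    let ?q = "\<lambda>v. 1 *\<^sub>R p' v + (- l) *\<^sub>R p v + 0" and ?M = "1 *\<^sub>R L' + (- l) *\<^sub>R L"
    note disp = displacement_combination[of Q 1 p' "- l" p 0 L' L]
    have "\<exists>\<alpha>. displacement Q ?q ?M b = \<alpha> *\<^sub>R d b" if "b \<in> cedges Q" for b
    proof -
      obtain \<beta> \<beta>' where "displacement Q p L b = \<beta> *\<^sub>R d b" "displacement Q p' L' b = \<beta>' *\<^sub>R d b"
        using f \<open>b \<in> cedges Q\<close> unfolding faithful_network_def by blast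
      then have "displacement Q ?q ?M b = (\<beta>' - l * \<beta>) *\<^sub>R d b"
        unfolding disp by (simp add: scaleR_left_diff_distrib)
      then show ?thesis by blast
    qed
    moreover have "displacement Q ?q ?M e0 = 0"
      unfolding disp using a a' by (simp add: l_def)
    ultimately have z: "\<forall>b\<in>cedges Q. displacement Q ?q ?M b = 0" using collapse[OF e0] by blast
    note triv = collapsed_imp_trivial[OF rank v0 z]
    have "L' = l *\<^sub>R L" using triv(1) by simp
    moreover have "p' v = l *\<^sub>R p v + ?q v0" if "v \<in> cverts Q" for v
      using triv(2)[OF that] by (simp add: algebra_simps)
    moreover have "l \<noteq> 0" using a a' by (simp add: l_def)
    ultimately show ?thesis by blast
  qed
  show ?thesis unfolding unique_network_def using ex uni by blast
qed

lemma generic_Laman: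
  assumes Laman: "colored_Laman Q"
  shows "\<exists>P. direction_polynomial (cedges Q) P \<and> (\<exists>d. P d \<noteq> 0) \<and>
    (\<forall>d. P d \<noteq> 0 \<longrightarrow> unique_network Q d)"
proof -
  let ?E = "cedges Q"
  have m: "card (cedges Q) = 2 * card (cverts Q) + 1"
    and count: "\<And>F. F \<subseteq> cedges Q \<Longrightarrow> F \<noteq> {} \<Longrightarrow> card F + 1 \<le> 2 * rk F"
    using Laman unfolding colored_Laman_iff by blast+
  have "?E \<noteq> {}" using m by force
  then have rank: "rk ?E = card (cverts Q) + 1"
    using count[OF subset_refl] m rk_le by linarith
  define good where "good = (\<lambda>e P. direction_polynomial ?E P \<and> (\<exists>d. P d \<noteq> 0) \<and>
    (\<forall>d p L. P d \<noteq> 0 \<longrightarrow> (\<forall>b\<in>?E. \<exists>\<alpha>. displacement Q p L b = \<alpha> *\<^sub>R d b) \<longrightarrow>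
      displacement Q p L e = 0 \<longrightarrow> (\<forall>b\<in>?E. displacement Q p L b = 0)))"
  have "\<exists>P. good e P" if e: "e \<in> ?E" for e
  proof -
    \<comment> \<open>The second copy of \<open>e\<close> uses up the slack of 1 in the sparsity
      bound. The empty set has no slack but is harmless.\<close>
    have "card F' + card (F' \<inter> {e}) \<le> 2 * rk F'" if "F' \<subseteq> ?E" for F'
    proof (cases "F' = {}")
      case False
      have "card (F' \<inter> {e}) \<le> 1" using card_mono[of "{e}" "F' \<inter> {e}"] by simp
      then show ?thesis using count[OF that False] by linarith
    qed simp
    \<comment> \<open>Tightness on the whole graph: (2n + 1) + 1 = 2(n + 1).\<close>
    from generic_collapse_network[OF subset_refl _ this] show ?thesis
      using e m rank by (simp add: good_def)
  qed
  then obtain P where P: "\<And>e. e \<in> ?E \<Longrightarrow> good e (P e)" by metis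
  \<comment> \<open>The squared length of a direction, a polynomial whose real zeros are exactly the
    zero directions.\<close>
  define N where "N = (\<lambda>e (d :: 'e \<Rightarrow> real^2). d e $ 1 * d e $ 1 + d e $ 2 * d e $ 2)"
  have N: "direction_polynomial ?E (N e)" if "e \<in> ?E" for e
    unfolding N_def using that by (intro direction_polynomial.intros)
  have N1: "N e (\<lambda>_. axis 1 1) \<noteq> 0" for e by (simp add: N_def axis_def)
  define R where "R = (\<lambda>e d. P e d * N e d)"
  have R: "direction_polynomial ?E (R e)" "\<exists>d. R e d \<noteq> 0" if e: "e \<in> ?E" for e
  proof -
    have Pe: "direction_polynomial ?E (P e)" "\<exists>d. P e d \<noteq> 0" using P[OF e] by (auto simp: good_def)
    show "direction_polynomial ?E (R e)"
      unfolding R_def using Pe(1) N[OF e] by (rule direction_polynomial.mult)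
    show "\<exists>d. R e d \<noteq> 0"
      unfolding R_def using Pe direction_polynomial_common_nonzero[OF Pe(1) N[OF e] _ N1] by blast
  qed
  have "direction_polynomial ?E (\<lambda>d. \<Prod>e\<in>?E. R e d)"
    by (rule direction_polynomial_prod(1)[OF finite_cedges]) (rule R, assumption)+
  moreover have "\<exists>d. (\<Prod>e\<in>?E. R e d) \<noteq> 0"
    by (rule direction_polynomial_prod(2)[OF finite_cedges]) (rule R, assumption)+
  moreover have "unique_network Q d" if "(\<Prod>e\<in>?E. R e d) \<noteq> 0" for d
  proof (rule unique_network_if_generic_Laman[OF Laman])
    have nz: "P e d \<noteq> 0 \<and> N e d \<noteq> 0" if "e \<in> ?E" for e
      using \<open>(\<Prod>e\<in>?E. R e d) \<noteq> 0\<close> that finite_cedges by (auto simp: R_def prod_zero_iff)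
    show "d e \<noteq> 0" if "e \<in> ?E" for e using nz[OF that] by (auto simp: N_def)
    show "\<forall>b\<in>?E. displacement Q p L b = 0"
      if "e \<in> ?E" "\<forall>b\<in>?E. \<exists>\<alpha>. displacement Q p L b = \<alpha> *\<^sub>R d b" "displacement Q p L e = 0" for p L e
      using P[OF that(1)] nz[OF that(1)] that(2,3) unfolding good_def by blast
  qed
  ultimately show ?thesis by blast
qed

text \<open>Valid for every \<open>d\<close>. One equation is left to spare, so a nonzero pinned
  solution \<open>q\<close> can also be made to collapse an edge \<open>e0\<close>. Adding a
  suitable multiple of \<open>q\<close> to a faithful \<open>p\<close> keeps it faithful and fixes
  its displacement on \<open>e0\<close>, which no nontrivial scaling does.\<close>

lemma not_unique_if_few_edges:
  assumes few: "card (cedges Q) \<le> 2 * card (cverts Q)"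
  shows "\<not> unique_network Q d"
proof
  assume u: "unique_network Q d"
  have uni: "\<exists>l t. l \<noteq> 0 \<and> (\<forall>v\<in>cverts Q. p' v = l *\<^sub>R p v + t) \<and> L' = l *\<^sub>R L"
    if "faithful_network Q d p L" "faithful_network Q d p' L'" for p L p' L'
    using u that unfolding unique_network_def by blast
  obtain v0 where v0: "v0 \<in> cverts Q" using cverts_nonempty by blast
  show False
  proof (cases "cedges Q = {}")
    case True
    \<comment> \<open>Without edges every pair is faithful; the zero realization cannot be scaled
      and translated into a pinned nonzero one.\<close>
    have "\<exists>p L. p v0 = 0 \<and> \<not> ((\<forall>v\<in>cverts Q. p v = 0) \<and> L = 0) \<and>
        (\<forall>e\<in>{}. displacement Q p L e \<bullet> 0 = 0)"
      by (rule exists_nonzero_network[OF _ _ v0]) simp_all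
    then obtain q :: "'v \<Rightarrow> real^2" and M :: "real^2^2"
      where q: "q v0 = 0" "\<not> ((\<forall>v\<in>cverts Q. q v = 0) \<and> M = 0)" by blast
    have "faithful_network Q d (\<lambda>_. 0) 0" "faithful_network Q d q M"
      by (simp_all add: faithful_network_def True)
    from uni[OF this] obtain l t where "\<forall>v\<in>cverts Q. q v = l *\<^sub>R 0 + t" "M = l *\<^sub>R 0" by blast
    then have "\<forall>v\<in>cverts Q. q v = t" "M = 0" by simp_all
    moreover from this have "t = 0" using q(1) v0 by simp
    ultimately show False using q(2) by simp
  next
    case False
    then obtain e0 where e0: "e0 \<in> cedges Q" by blast
    obtain p L where f: "faithful_network Q d p L" using u unfolding unique_network_def by blast
    have pnz: "displacement Q p L e \<noteq> 0" if "e \<in> cedges Q" for e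
      using f that unfolding faithful_network_def by blast
    have dnz: "d e \<noteq> 0" if "e \<in> cedges Q" for e
    proof -
      obtain a where "displacement Q p L e = a *\<^sub>R d e"
        using f \<open>e \<in> cedges Q\<close> unfolding faithful_network_def by blast
      then show ?thesis using pnz[OF that] by auto
    qed
    \<comment> \<open>The extra index asks the displacement of \<open>e0\<close> to be orthogonal to
      \<open>d e0\<close>; being parallel to it as well, it is zero.\<close>
    let ?I = "Inl ` cedges Q \<union> {Inr ()}"
    have cI: "card ?I \<le> 2 * card (cverts Q) + 1"
      using few finite_cedges by (simp add: card_insert_if card_image inj_on_def image_iff)
    have "\<exists>q M. q v0 = 0 \<and> \<not> ((\<forall>v\<in>cverts Q. q v = 0) \<and> M = 0) \<and>
      (\<forall>i\<in>?I. displacement Q q M (case i of Inl e \<Rightarrow> e | Inr _ \<Rightarrow> e0) \<bullet>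
        (case i of Inl e \<Rightarrow> perp (d e) | Inr _ \<Rightarrow> d e0) = 0)"
      by (rule exists_nonzero_network[OF _ cI v0]) (use finite_cedges e0 in auto)
    then obtain q M where q: "q v0 = 0" "\<not> ((\<forall>v\<in>cverts Q. q v = 0) \<and> M = 0)"
      "\<forall>i\<in>?I. displacement Q q M (case i of Inl e \<Rightarrow> e | Inr _ \<Rightarrow> e0) \<bullet>
        (case i of Inl e \<Rightarrow> perp (d e) | Inr _ \<Rightarrow> d e0) = 0"
      by blast
    have par: "\<exists>\<alpha>. displacement Q q M e = \<alpha> *\<^sub>R d e" if "e \<in> cedges Q" for e
      using q(3)[rule_format, of "Inl e"] that dnz by (intro parallel_if_perp_zero) auto
    have q0: "displacement Q q M e0 = 0"
      using par[OF e0] q(3)[rule_format, of "Inr ()"] dnz[OF e0] by auto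
    \<comment> \<open>Each edge forbids at most one factor, because its displacement under
      \<open>p\<close> is nonzero. The value 0 is excluded too, to make the perturbation
      genuine.\<close>
    let ?bad = "\<lambda>e. {s. displacement Q p L e + s *\<^sub>R displacement Q q M e = 0}"
    have "finite (?bad e)" if "e \<in> cedges Q" for e
    proof (rule finite_subset)
      let ?x = "displacement Q p L e" and ?y = "displacement Q q M e"
      show "?bad e \<subseteq> {- (?x \<bullet> ?y) / (?y \<bullet> ?y)}"
      proof
        fix s assume "s \<in> ?bad e"
        then have s: "?x + s *\<^sub>R ?y = 0" by simp
        then have "?y \<bullet> ?y \<noteq> 0" using pnz[OF that] by auto
        moreover have "?x \<bullet> ?y + s * (?y \<bullet> ?y) = 0"
          using arg_cong[OF s, of "\<lambda>z. z \<bullet> ?y"] by (simp add: inner_add_left)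
        ultimately show "s \<in> {- (?x \<bullet> ?y) / (?y \<bullet> ?y)}" by (simp add: field_simps)
      qed
    qed simp
    then have "finite (insert 0 (\<Union>e\<in>cedges Q. ?bad e))" using finite_cedges by simp
    then obtain s :: real where s: "s \<notin> insert 0 (\<Union>e\<in>cedges Q. ?bad e)"
      using ex_new_if_finite[OF infinite_UNIV_char_0] by blast
    let ?p = "\<lambda>v. 1 *\<^sub>R p v + s *\<^sub>R q v + 0" and ?L = "1 *\<^sub>R L + s *\<^sub>R M"
    note disp = displacement_combination[of Q 1 p s q 0 L M]
    have "faithful_network Q d ?p ?L"
      unfolding faithful_network_def disp
    proof (intro ballI conjI)
      fix e assume e: "e \<in> cedges Q"
      obtain \<alpha> \<beta> where "displacement Q p L e = \<alpha> *\<^sub>R d e" "displacement Q q M e = \<beta> *\<^sub>R d e"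
        using f par e unfolding faithful_network_def by blast
      then have "1 *\<^sub>R displacement Q p L e + s *\<^sub>R displacement Q q M e = (\<alpha> + s * \<beta>) *\<^sub>R d e"
        by (simp add: scaleR_left_distrib)
      then show "\<exists>\<alpha>. 1 *\<^sub>R displacement Q p L e + s *\<^sub>R displacement Q q M e = \<alpha> *\<^sub>R d e" by blast
      show "1 *\<^sub>R displacement Q p L e + s *\<^sub>R displacement Q q M e \<noteq> 0" using s e by auto
    qed
    from uni[OF f this] obtain l t where lt: "\<forall>v\<in>cverts Q. ?p v = l *\<^sub>R p v + t" "?L = l *\<^sub>R L" by blast
    have "displacement Q ?p ?L e0 = l *\<^sub>R displacement Q p L e0"
      using lt ends_in_cverts[OF e0]
      by (simp add: displacement_def scaleR_matrix_vector_assoc[symmetric] algebra_simps)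
    then have "displacement Q p L e0 = l *\<^sub>R displacement Q p L e0" unfolding disp q0 by simp
    then have "(1 - l) *\<^sub>R displacement Q p L e0 = 0" by (simp add: scaleR_left_diff_distrib)
    then have l: "l = 1" using pnz[OF e0] by simp
    have "t = 0" using bspec[OF lt(1) v0] q(1) l by simp
    then have "\<forall>v\<in>cverts Q. q v = 0" using lt(1) l s by simp
    moreover have "M = 0" using lt(2) l s by simp
    ultimately show False using q(2) by blast
  qed
qed

text \<open>In a minimal violating set all proper subsets satisfy the covering condition. If the set
  is tight, it is generically collapsed. If it violates strictly, deleting an edge would leave a
  smaller violation, so it is a single edge with zero vector, collapsed by every
  realization.\<close>

lemma generic_not_faithful:
  assumes F: "F \<subseteq> cedges Q" "F \<noteq> {}" "2 * rk F \<le> card F"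
  shows "\<exists>P. direction_polynomial (cedges Q) P \<and> (\<exists>d. P d \<noteq> 0) \<and>
    (\<forall>d p L. P d \<noteq> 0 \<longrightarrow> \<not> faithful_network Q d p L)"
  using F
proof (induction "card F" arbitrary: F rule: less_induct)
  case less
  have fin: "finite F" using less.prems finite_cedges finite_subset by blast
  show ?case
  proof (cases "\<exists>F'. F' \<subset> F \<and> F' \<noteq> {} \<and> 2 * rk F' \<le> card F'")
    case True
    then obtain F' where F': "F' \<subset> F" "F' \<noteq> {}" "2 * rk F' \<le> card F'" by blast
    have "card F' < card F" using F'(1) fin by (rule psubset_card_mono[rotated])
    then show ?thesis using F' less.prems(1) by (intro less.hyps[of F']) auto
  next
    case minimal: False
    obtain e where e: "e \<in> F" using less.prems by blast
    show ?thesis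
    proof (cases "card F = 2 * rk F")
      case True
      have count: "card F' + card (F' \<inter> {}) \<le> 2 * rk F'" if "F' \<subseteq> F" for F'
      proof (cases "F' = F \<or> F' = {}")
        case False
        then have "F' \<subset> F" using that by blast
        then have "\<not> 2 * rk F' \<le> card F'" using minimal False by blast
        then show ?thesis by simp
      qed (use True in auto)
      have "card F + card {} = 2 * rk F" using True by simp
      from generic_collapse_network[OF less.prems(1) empty_subsetI count this] obtain P
        where P: "direction_polynomial (cedges Q) P" "\<exists>d. P d \<noteq> 0"
        "\<forall>d p L. P d \<noteq> 0 \<longrightarrow> (\<forall>e\<in>F. \<exists>\<alpha>. displacement Q p L e = \<alpha> *\<^sub>R d e) \<longrightarrow>
          (\<forall>e\<in>{}. displacement Q p L e = 0) \<longrightarrow> (\<forall>e\<in>F. displacement Q p L e = 0)"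
        by blast
      have "\<not> faithful_network Q d p L" if "P d \<noteq> 0" for d p L
        using P(3)[rule_format, OF that, of p L] e less.prems(1) unfolding faithful_network_def by blast
      then show ?thesis using P(1,2) by blast
    next
      case False
      \<comment> \<open>The degenerate case: the surviving edge is a self-loop of color 0.\<close>
      then have gt: "2 * rk F < card F" using less.prems by linarith
      have "F = {e}"
      proof (rule ccontr)
        assume "F \<noteq> {e}"
        then have ne: "F - {e} \<noteq> {}" using e by blast
        have "rk (F - {e}) \<le> rk F" using fin by (intro family_rank_mono) auto
        moreover have "card (F - {e}) = card F - 1" using e by simp
        ultimately have "2 * rk (F - {e}) \<le> card (F - {e})" using gt by linarith
        then show False using minimal ne e by blast
      qed
      then have rk0: "rk {e} = 0" using gt by simp
      have "edge_vec Q e = 0"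
      proof (rule ccontr)
        assume "edge_vec Q e \<noteq> 0"
        then have "independent {edge_vec Q e}" by simp
        then have "dim {edge_vec Q e} = 1" using dim_eq_card_independent by fastforce
        then show False using rk0 by (simp add: family_rank_def)
      qed
      then have "displacement Q p L e = 0" for p L
        using frame_map_edge[OF subsetD[OF less.prems(1) e], of p L] linear_0[OF linear_frame_map[of Q p L]] by simp
      then have "\<not> faithful_network Q d p L" for d p L
        using e less.prems(1) unfolding faithful_network_def by blast
      then show ?thesis
        by (intro exI[of _ "\<lambda>_. 1"]) (auto intro: direction_polynomial.const)
    qed
  qed
qed

theorem generic_unique_network_iff:
  "\<exists>P. direction_polynomial (cedges Q) P \<and> (\<exists>d. P d \<noteq> 0) \<and>
    (\<forall>d. P d \<noteq> 0 \<longrightarrow> (unique_network Q d \<longleftrightarrow> colored_Laman Q))"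
proof (cases "colored_Laman Q")
  case True
  then show ?thesis using generic_Laman by simp
next
  case not_Laman: False
  show ?thesis
  proof (cases "card (cedges Q) \<le> 2 * card (cverts Q)")
    case True
    then show ?thesis using not_Laman not_unique_if_few_edges
      by (intro exI[of _ "\<lambda>_. 1"]) (auto intro: direction_polynomial.const)
  next
    case False
    have "\<exists>F\<subseteq>cedges Q. F \<noteq> {} \<and> 2 * rk F \<le> card F"
    proof (cases "card (cedges Q) = 2 * card (cverts Q) + 1")
      case True
      then obtain F where F: "F \<subseteq> cedges Q" "F \<noteq> {}" "\<not> card F + 1 \<le> 2 * rk F"
        using not_Laman unfolding colored_Laman_iff by blast
      then show ?thesis by (intro exI[of _ F]) auto
    next
      case m: False
      \<comment> \<open>With at least 2n + 2 edges the whole edge set is a violation, since its rank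
        is at most n + 1.\<close>
      have "2 * rk (cedges Q) \<le> card (cedges Q)" using rk_le m False by linarith
      moreover have "cedges Q \<noteq> {}" using False by force
      ultimately show ?thesis by blast
    qed
    then obtain F where F: "F \<subseteq> cedges Q" "F \<noteq> {}" "2 * rk F \<le> card F" by blast
    from generic_not_faithful[OF this] obtain P where P: "direction_polynomial (cedges Q) P"
      "\<exists>d. P d \<noteq> 0" "\<And>d p L. P d \<noteq> 0 \<Longrightarrow> \<not> faithful_network Q d p L"
      by blast
    have "\<not> unique_network Q d" if "P d \<noteq> 0" for d
      using P(3)[OF that] unfolding unique_network_def by blast
    then show ?thesis using P(1,2) not_Laman by blast
  qed
qed

end

section \<open>Lifting to the periodic graph\<close>

lemma free_action_eq_imp:
  assumes "free_action_on act A" "a \<in> A" "act g a = act h a"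
  shows "g = h"
proof -
  have "act (- h + g) a = act (- h) (act g a)" "act (- h + h) a = act (- h) (act h a)"
    "act 0 a = a" "act (- h + g) a = a \<longrightarrow> - h + g = 0"
    using assms(1,2) unfolding free_action_on_def by blast+
  then have "- h + g = 0" using assms(3) by simp
  then show ?thesis by simp
qed

lemma orbit_eq:
  assumes "free_action_on act A" "a \<in> A" "b \<in> orbit act a"
  shows "orbit act b = orbit act a" "b \<in> A"
proof -
  have add: "act (g + h) a = act g (act h a)" and closed: "act g a \<in> A" for g h
    using assms(1,2) unfolding free_action_on_def by blast+
  obtain g where g: "b = act g a" using assms(3) by (auto simp: orbit_def)
  then show "b \<in> A" using closed by simp
  have b: "act h b = act (h + g) a" and a: "act h a = act (h - g) b" for h
    using g add[of h g] add[of "h - g" g] by simp_all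
  show "orbit act b = orbit act a"
  proof (rule subset_antisym)
    show "orbit act b \<subseteq> orbit act a" unfolding orbit_def by (auto simp: b)
    show "orbit act a \<subseteq> orbit act b" unfolding orbit_def by (auto simp: a)
  qed
qed

locale periodic_network =
  fixes G :: "('v, 'e) periodic_multigraph" and src tgt :: "'e \<Rightarrow> 'v" and rep :: "'v set \<Rightarrow> 'v"
    and Q :: "('v set, 'e set) colored_graph"
  assumes periodic: "is_periodic_multigraph G"
    and orientation: "invariant_orientation G src tgt"
    and representatives: "orbit_representatives G rep"
    and Q_def: "Q = quotient_colored_graph G src tgt rep"
begin

lemma vfree: "free_action_on (vact G) (Verts G)"
  using periodic by (simp add: is_periodic_multigraph_def)

lemma vact_closed: "v \<in> Verts G \<Longrightarrow> vact G g v \<in> Verts G"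
  and vact_add: "v \<in> Verts G \<Longrightarrow> vact G (g + h) v = vact G g (vact G h v)"
  and vact_0: "v \<in> Verts G \<Longrightarrow> vact G 0 v = v"
  using vfree unfolding free_action_on_def by blast+

lemma src_eact: "e \<in> Edges G \<Longrightarrow> src (eact G g e) = vact G g (src e)"
  and tgt_eact: "e \<in> Edges G \<Longrightarrow> tgt (eact G g e) = vact G g (tgt e)"
  using orientation unfolding invariant_orientation_def by blast+

lemma ends_in_Verts:
  assumes "e \<in> Edges G"
  shows "src e \<in> Verts G" "tgt e \<in> Verts G"
proof -
  have "set_uprod (ends G e) \<subseteq> Verts G" "ends G e = Upair (src e) (tgt e)"
    using assms periodic orientation
    unfolding is_periodic_multigraph_def invariant_orientation_def by blast+
  then show "src e \<in> Verts G" "tgt e \<in> Verts G" by auto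
qed

lemma cverts_Q: "cverts Q = orbit (vact G) ` Verts G"
  and cedges_Q: "cedges Q = orbit (eact G) ` Edges G"
  by (simp_all add: Q_def quotient_colored_graph_def)

lemma src_orbit: "e \<in> Edges G \<Longrightarrow> src ` orbit (eact G) e = orbit (vact G) (src e)"
  and tgt_orbit: "e \<in> Edges G \<Longrightarrow> tgt ` orbit (eact G) e = orbit (vact G) (tgt e)"
  by (simp_all add: orbit_def image_image src_eact tgt_eact)

lemma tail_Q: "e \<in> Edges G \<Longrightarrow> tail Q (orbit (eact G) e) = orbit (vact G) (src e)"
  and head_Q: "e \<in> Edges G \<Longrightarrow> head Q (orbit (eact G) e) = orbit (vact G) (tgt e)"
  by (simp_all add: Q_def quotient_colored_graph_def src_orbit tgt_orbit)

lemma rep_in: "v \<in> Verts G \<Longrightarrow> rep (orbit (vact G) v) \<in> orbit (vact G) v"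
  using representatives unfolding orbit_representatives_def by blast

lemma rep_Verts: "v \<in> Verts G \<Longrightarrow> rep (orbit (vact G) v) \<in> Verts G"
  and orbit_rep: "v \<in> Verts G \<Longrightarrow> orbit (vact G) (rep (orbit (vact G) v)) = orbit (vact G) v"
  using orbit_eq[OF vfree _ rep_in] by blast+

lemma vert_in_own_orbit: "v \<in> Verts G \<Longrightarrow> v \<in> orbit (vact G) v"
  unfolding orbit_def using vact_0 by (metis rangeI)

lemma exists_shift:
  assumes "v \<in> Verts G"
  shows "\<exists>g. v = vact G g (rep (orbit (vact G) v))"
proof -
  have "v \<in> orbit (vact G) (rep (orbit (vact G) v))"
    using vert_in_own_orbit[OF assms] by (simp add: orbit_rep[OF assms])
  then show ?thesis unfolding orbit_def by blast
qed

text \<open>Freeness of the vertex action, applied at the tail and then at the representative of the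
  head, makes the description of the color unique. The witness \<open>g\<close> moves
  \<open>e\<close> to the lift that starts at the chosen representative.\<close>

lemma color_Q:
  assumes e: "e \<in> Edges G"
  shows "\<exists>g. src (eact G g e) = rep (orbit (vact G) (src e)) \<and>
    tgt (eact G g e) = vact G (color Q (orbit (eact G) e)) (rep (orbit (vact G) (tgt e)))"
proof -
  note V = ends_in_Verts[OF e]
  let ?i = "rep (orbit (vact G) (src e))" and ?j = "rep (orbit (vact G) (tgt e))"
  obtain g where g: "?i = vact G g (src e)" using rep_in[OF V(1)] by (auto simp: orbit_def)
  have "tgt (eact G g e) \<in> orbit (vact G) (tgt e)" by (simp add: tgt_eact[OF e] orbit_def)
  then have "tgt (eact G g e) \<in> orbit (vact G) ?j" by (simp add: orbit_rep[OF V(2)])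
  then obtain h where h: "tgt (eact G g e) = vact G h ?j" by (auto simp: orbit_def)
  have "color Q (orbit (eact G) e) = (THE h. \<exists>e'\<in>orbit (eact G) e. src e' = ?i \<and> tgt e' = vact G h ?j)"
    by (simp add: Q_def quotient_colored_graph_def src_orbit[OF e] tgt_orbit[OF e])
  also have "\<dots> = h"
  proof (rule the_equality)
    show "\<exists>e'\<in>orbit (eact G) e. src e' = ?i \<and> tgt e' = vact G h ?j"
      using g h by (intro bexI[of _ "eact G g e"]) (auto simp: src_eact[OF e] orbit_def)
    fix h' assume "\<exists>e'\<in>orbit (eact G) e. src e' = ?i \<and> tgt e' = vact G h' ?j"
    then obtain g' where g': "src (eact G g' e) = ?i" "tgt (eact G g' e) = vact G h' ?j"
      by (auto simp: orbit_def)
    have "vact G g' (src e) = vact G g (src e)" using g' g by (simp add: src_eact[OF e])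
    then have "g' = g" by (rule free_action_eq_imp[OF vfree V(1)])
    then have "vact G h' ?j = vact G h ?j" using g' h by simp
    then show "h' = h" by (rule free_action_eq_imp[OF vfree rep_Verts[OF V(2)]])
  qed
  finally show ?thesis using g h by (intro exI[of _ g]) (simp add: src_eact[OF e])
qed

sublocale finite_colored_graph Q
proof
  show "finite (cverts Q)" "finite (cedges Q)"
    using periodic by (simp_all add: cverts_Q cedges_Q is_periodic_multigraph_def)
  have "Verts G \<noteq> {}" using periodic by (auto simp: is_periodic_multigraph_def)
  then show "cverts Q \<noteq> {}" by (simp add: cverts_Q)
  show "tail Q \<epsilon> \<in> cverts Q \<and> head Q \<epsilon> \<in> cverts Q" if "\<epsilon> \<in> cedges Q" for \<epsilon>
    using that by (auto simp: cedges_Q cverts_Q tail_Q head_Q ends_in_Verts)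
qed

definition equivariant :: "('v \<Rightarrow> real^2) \<Rightarrow> real^2^2 \<Rightarrow> bool" where
  "equivariant p L \<longleftrightarrow> (\<forall>g. \<forall>v\<in>Verts G. p (vact G g v) = p v + L *v real_vec g)"

text \<open>Moving \<open>e\<close> to its standard lift shifts both endpoints by the same vector
  \<open>L *v real_vec g\<close>, which cancels in the difference.\<close>

lemma displacement_lift:
  assumes eq: "equivariant p L" and e: "e \<in> Edges G"
  shows "displacement Q (\<lambda>i. p (rep i)) L (orbit (eact G) e) = p (tgt e) - p (src e)"
proof -
  note V = ends_in_Verts[OF e]
  have shift: "p (vact G g v) = p v + L *v real_vec g" if "v \<in> Verts G" for g v
    using eq that by (simp add: equivariant_def)
  obtain g where g: "src (eact G g e) = rep (orbit (vact G) (src e))"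
    "tgt (eact G g e) = vact G (color Q (orbit (eact G) e)) (rep (orbit (vact G) (tgt e)))"
    using color_Q[OF e] by blast
  have t: "p (tgt e) + L *v real_vec g = p (rep (orbit (vact G) (tgt e))) + L *v real_vec (color Q (orbit (eact G) e))"
    using arg_cong[OF g(2), of p] by (simp add: tgt_eact[OF e] shift[OF V(2)] shift[OF rep_Verts[OF V(2)]])
  have s: "p (src e) + L *v real_vec g = p (rep (orbit (vact G) (src e)))"
    using arg_cong[OF g(1), of p] by (simp add: src_eact[OF e] shift[OF V(1)])
  show ?thesis unfolding displacement_def tail_Q[OF e] head_Q[OF e] t[symmetric] s[symmetric] by simp
qed

lemma faithful_realization_iff:
  "faithful_realization G src tgt (lifted_directions G d) p L \<longleftrightarrow>
    equivariant p L \<and> faithful_network Q d (\<lambda>i. p (rep i)) L"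
proof -
  have "(\<forall>e\<in>Edges G. \<exists>\<alpha>. p (tgt e) - p (src e) = \<alpha> *\<^sub>R lifted_directions G d e) \<and>
        (\<forall>e\<in>Edges G. p (src e) \<noteq> p (tgt e)) \<longleftrightarrow> faithful_network Q d (\<lambda>i. p (rep i)) L"
    if "equivariant p L"
    unfolding faithful_network_def cedges_Q lifted_directions_def
    by (auto simp: displacement_lift[OF that])
  then show ?thesis
    unfolding faithful_realization_def realization_def
    by (auto simp: equivariant_def real_vec_def)
qed

section \<open>Extending positions of representatives to the periodic graph\<close>

definition shift_of :: "'v \<Rightarrow> int^2" where
  "shift_of v = (SOME g. v = vact G g (rep (orbit (vact G) v)))"

definition lift :: "('v set \<Rightarrow> real^2) \<Rightarrow> real^2^2 \<Rightarrow> 'v \<Rightarrow> real^2" where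
  "lift q L v = q (orbit (vact G) v) + L *v real_vec (shift_of v)"

lemma shift_of: "v \<in> Verts G \<Longrightarrow> vact G (shift_of v) (rep (orbit (vact G) v)) = v"
  unfolding shift_of_def using someI_ex[OF exists_shift] by simp

lemma shift_of_vact:
  assumes v: "v \<in> Verts G"
  shows "shift_of (vact G g v) = g + shift_of v"
proof -
  let ?r = "rep (orbit (vact G) v)"
  have o: "orbit (vact G) (vact G g v) = orbit (vact G) v"
    by (rule orbit_eq(1)[OF vfree v]) (simp add: orbit_def)
  have "vact G (shift_of (vact G g v)) ?r = vact G g v"
    using shift_of[OF vact_closed[OF v, of g]] by (simp add: o)
  also have "\<dots> = vact G (g + shift_of v) ?r"
    by (simp add: vact_add[OF rep_Verts[OF v]] shift_of[OF v])
  finally show ?thesis by (rule free_action_eq_imp[OF vfree rep_Verts[OF v]])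
qed

lemma shift_of_rep:
  assumes v: "v \<in> Verts G"
  shows "shift_of (rep (orbit (vact G) v)) = 0"
proof -
  let ?r = "rep (orbit (vact G) v)"
  have "vact G (shift_of ?r) ?r = vact G 0 ?r"
    using shift_of[OF rep_Verts[OF v]] by (simp add: orbit_rep[OF v] vact_0 rep_Verts[OF v])
  then show ?thesis by (rule free_action_eq_imp[OF vfree rep_Verts[OF v]])
qed

lemma equivariant_lift: "equivariant (lift q L) L"
  unfolding equivariant_def
proof (intro allI ballI)
  fix g v assume v: "v \<in> Verts G"
  have "orbit (vact G) (vact G g v) = orbit (vact G) v"
    by (rule orbit_eq(1)[OF vfree v]) (simp add: orbit_def)
  then show "lift q L (vact G g v) = lift q L v + L *v real_vec g"
    by (simp add: lift_def shift_of_vact[OF v] matrix_vector_right_distrib)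
qed

lemma lift_rep: "i \<in> cverts Q \<Longrightarrow> lift q L (rep i) = q i"
  by (auto simp: cverts_Q lift_def shift_of_rep orbit_rep)

lemma faithful_lift:
  assumes "faithful_network Q d q L"
  shows "faithful_realization G src tgt (lifted_directions G d) (lift q L) L"
proof -
  have "displacement Q (\<lambda>i. lift q L (rep i)) L \<epsilon> = displacement Q q L \<epsilon>" if "\<epsilon> \<in> cedges Q" for \<epsilon>
    using ends_in_cverts[OF that] by (simp add: displacement_def lift_rep)
  then show ?thesis
    using assms by (simp add: faithful_realization_iff equivariant_lift faithful_network_def)
qed

lemma unique_faithful_realization_iff:
  "unique_faithful_realization G src tgt (lifted_directions G d) \<longleftrightarrow> unique_network Q d"
proof
  assume u: "unique_faithful_realization G src tgt (lifted_directions G d)"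
  have ex: "\<exists>q L. faithful_network Q d q L"
    using u unfolding unique_faithful_realization_def faithful_realization_iff by blast
  have "\<exists>l t. l \<noteq> 0 \<and> (\<forall>i\<in>cverts Q. q' i = l *\<^sub>R q i + t) \<and> L' = l *\<^sub>R L"
    if f: "faithful_network Q d q L" "faithful_network Q d q' L'" for q L q' L'
  proof -
    obtain l t where lt: "l \<noteq> 0" "\<forall>v\<in>Verts G. lift q' L' v = l *\<^sub>R lift q L v + t" "L' = l *\<^sub>R L"
      using u faithful_lift[OF f(1)] faithful_lift[OF f(2)]
      unfolding unique_faithful_realization_def by blast
    have "q' i = l *\<^sub>R q i + t" if i: "i \<in> cverts Q" for i
    proof -
      have "rep i \<in> Verts G" using i by (auto simp: cverts_Q rep_Verts)
      from bspec[OF lt(2) this] show ?thesis by (simp add: lift_rep[OF i])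
    qed
    then show ?thesis using lt by blast
  qed
  then show "unique_network Q d" using ex unfolding unique_network_def by blast
next
  assume u: "unique_network Q d"
  have ex: "\<exists>p L. faithful_realization G src tgt (lifted_directions G d) p L"
    using u faithful_lift unfolding unique_network_def by blast
  have "\<exists>l t. l \<noteq> 0 \<and> (\<forall>v\<in>Verts G. p' v = l *\<^sub>R p v + t) \<and> L' = l *\<^sub>R L"
    if f: "faithful_realization G src tgt (lifted_directions G d) p L"
      "faithful_realization G src tgt (lifted_directions G d) p' L'" for p L p' L'
  proof -
    have eq: "equivariant p L" "equivariant p' L'"
      and fn: "faithful_network Q d (\<lambda>i. p (rep i)) L" "faithful_network Q d (\<lambda>i. p' (rep i)) L'"
      using f by (simp_all add: faithful_realization_iff)
    obtain l t where lt: "l \<noteq> 0" "\<forall>i\<in>cverts Q. p' (rep i) = l *\<^sub>R p (rep i) + t" "L' = l *\<^sub>R L"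
      using u fn unfolding unique_network_def by blast
    have "p' v = l *\<^sub>R p v + t" if v: "v \<in> Verts G" for v
    proof -
      let ?r = "rep (orbit (vact G) v)" and ?g = "shift_of v"
      \<comment> \<open>Equivariance recovers \<open>p\<close> from the representatives and
        \<open>L\<close>; scaling \<open>L\<close> by the same \<open>l\<close> extends the relation
        to the whole orbit.\<close>
      have "p (vact G ?g ?r) = p ?r + L *v real_vec ?g" "p' (vact G ?g ?r) = p' ?r + L' *v real_vec ?g"
        using eq rep_Verts[OF v] unfolding equivariant_def by blast+
      then have "p v = p ?r + L *v real_vec ?g" "p' v = p' ?r + L' *v real_vec ?g"
        by (simp_all add: shift_of[OF v])
      moreover have "p' ?r = l *\<^sub>R p ?r + t" using lt(2) v by (simp add: cverts_Q)
      ultimately show ?thesis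
        by (simp add: lt(3) scaleR_matrix_vector_assoc[symmetric] algebra_simps)
    qed
    then show ?thesis using lt by blast
  qed
  then show "unique_faithful_realization G src tgt (lifted_directions G d)"
    using ex unfolding unique_faithful_realization_def by blast
qed

end

section \<open>From a nonvanishing polynomial to a proper algebraic subset\<close>

lemma generic_imp_algebraic_subset:
  assumes P: "direction_polynomial E P" "\<exists>d. P d \<noteq> 0"
    and good: "\<And>d. P d \<noteq> 0 \<Longrightarrow> \<Phi> d"
  shows "\<exists>X. algebraic_subset E X \<and> X \<noteq> direction_space E \<and> (\<forall>d \<in> direction_space E - X. \<Phi> d)"
proof (intro exI[of _ "{d \<in> direction_space E. \<forall>f\<in>{P}. f d = 0}"] conjI)
  let ?X = "{d \<in> direction_space E. \<forall>f\<in>{P}. f d = 0}"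
  show "algebraic_subset E ?X"
    unfolding algebraic_subset_def using P(1) by (intro exI[of _ "{P}"]) simp
  obtain d where d: "P d \<noteq> 0" using P(2) by blast
  \<comment> \<open>The point \<open>d\<close> is an arbitrary function; only its restriction
    belongs to the extensional space of assignments.\<close>
  have "P (restrict d E) = P d" by (rule direction_polynomial_cong[OF P(1)]) simp
  then have "restrict d E \<in> direction_space E - ?X" using d by (simp add: direction_space_def)
  then show "?X \<noteq> direction_space E" by blast
  show "\<forall>d\<in>direction_space E - ?X. \<Phi> d" using good by simp
qed

theorem theorem2:
  fixes G :: "('v, 'e) periodic_multigraph"
    and src tgt :: "'e \<Rightarrow> 'v"
    and rep :: "'v set \<Rightarrow> 'v"
    and Q :: "('v set, 'e set) colored_graph"
  assumes "is_periodic_multigraph G"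
    and "invariant_orientation G src tgt"
    and "orbit_representatives G rep"
    and "Q = quotient_colored_graph G src tgt rep"
  shows "\<exists>X. algebraic_subset (cedges Q) X \<and> X \<noteq> direction_space (cedges Q) \<and>
           (\<forall>d \<in> direction_space (cedges Q) - X.
              unique_faithful_realization G src tgt (lifted_directions G d) \<longleftrightarrow> colored_Laman Q)"
proof -
  interpret periodic_network G src tgt rep Q
    by (rule periodic_network.intro) (fact assms)+
  obtain P where P: "direction_polynomial (cedges Q) P" "\<exists>d. P d \<noteq> 0"
    and iff: "\<And>d. P d \<noteq> 0 \<Longrightarrow> unique_network Q d \<longleftrightarrow> colored_Laman Q"
    using generic_unique_network_iff by blast
  show ?thesis
    by (rule generic_imp_algebraic_subset[OF P]) (simp add: unique_faithful_realization_iff iff)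
qed

end
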